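(* Let $(E,d,\mu)$ be a locally compact separable metric measure space with $\mu$ a Radon measure of full support, $V(x,r)=\mu(B(x,r))$, and suppose there are constants $c_1,c_2>0$ and $d_2\ge d_1>0$ with $$c_1\left(\frac Rr\right)^{d_1}\le\frac{V(x,R)}{V(x,r)}\le c_2\left(\frac Rr\right)^{d_2}\quad\text{for all }x\in E,\ 0<r\le R.$$ Let $S$ be a driftless subordinator satisfying the scaling and monotonicity assumptions stated in the context, with Laplace exponent $\phi$ and densities $\bar p(r,\cdot)$ of $S_r$. Let $\Phi:[0,\infty)\to[0,\infty)$ be strictly increasing with $\Phi(0)=0$ and suppose there are constants $c_3,c_4>0$ and $0<\alpha_1\le\alpha_2<\infty$ with $c_3(R/r)^{\alpha_1}\le\Phi(R)/\Phi(r)\le c_4(R/r)^{\alpha_2}$ for all $0<r\le R$. Let $\{P^0_t;t\ge0\}$ be a uniformly bounded and strongly continuous semigroup on $L^p(E;\mu)$, $p\ge1$, or on $C_\infty(E)$, corresponding to a pure jump strong Markov process, with density $p^0(t,x,y)$ with respect to $\mu$ such that $$p^0(t,x,y)\simeq\frac1{V(x,\Phi^{-1}(t))}\wedge\frac t{V(x,d(x,y))\,\Phi(d(x,y))},\qquad t>0,\ x,y\in E.$$ Let $q(t,x,y)=\int_0^\infty p^0(r,x,y)\,\bar p(r,t)\,dr$. Then: (i) If $\Phi(d(x,y))\phi(t^{-1})\le1$, then $$q(t,x,y)\simeq\frac{\phi(t^{-1})}t\int_{\Phi(d(x,y))}^{2/\phi(t^{-1})}\frac r{V(x,\Phi^{-1}(r))}\,dr.$$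 (ii) If $\Phi(d(x,y))\phi(t^{-1})\ge1$, then $$q(t,x,y)\simeq\frac1{t\,\phi(t^{-1})^2\,V(x,d(x,y))\,\Phi(d(x,y))}.$$
   Context: Assumptions on the driftless subordinator $S$ ($\mathbb E[e^{-\lambda S_t}]=e^{-t\phi(\lambda)}$, $\phi(\lambda)=\int_0^\infty(1-e^{-\lambda x})\,\nu(dx)$): (a) there are $0<\beta_1<\beta_2<1$ and constants $k_1,k_2>0$ with $k_1\kappa^{\beta_1}\le\phi(\kappa\lambda)/\phi(\lambda)\le k_2\kappa^{\beta_2}$ for all $\lambda>0$, $\kappa\ge1$, with the normalization $\phi(1)=1$; (b) the Lévy measure has a density $\nu(z)$ with respect to Lebesgue measure such that $t\mapsto t\nu(t)$ is non-increasing on $(0,\infty)$. Under these assumptions $S_r$ has a bounded density $\bar p(r,t)$, smooth in $t$, for each $r>0$. $h\simeq k$ means $c'k\le h\le c''k$ for constants $c',c''>0$ independent of $t>0$, $x,y\in E$ in the specified range. $a\wedge b=\min\{a,b\}$; when $d(x,y)=0$ the second term in the minimum is $+\infty$. $\Phi^{-1}$ is the (right-continuous generalized) inverse of $\Phi$. $B(x,r)$ is the open ball; $C_\infty(E)$ is the space of continuous functions vanishing at infinity. *)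

theory Defs
  imports "HOL-Probability.Probability"
begin

section \<open>The metric measure space\<close>

definition radon_measure :: "'a::metric_space measure \<Rightarrow> bool" where
  "radon_measure \<mu> \<longleftrightarrow>
     sets \<mu> = sets borel \<and>
     (\<forall>K. compact K \<longrightarrow> emeasure \<mu> K < \<infinity>) \<and>
     (\<forall>A\<in>sets borel. emeasure \<mu> A = (INF U\<in>{U. open U \<and> A \<subseteq> U}. emeasure \<mu> U)) \<and>
     (\<forall>U. open U \<longrightarrow> emeasure \<mu> U = (SUP K\<in>{K. compact K \<and> K \<subseteq> U}. emeasure \<mu> K))"

definition full_support :: "'a::metric_space measure \<Rightarrow> bool" where
  "full_support \<mu> \<longleftrightarrow> (\<forall>U. open U \<longrightarrow> U \<noteq> {} \<longrightarrow> emeasure \<mu> U > 0)"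

text \<open>The value of \<^const>\<open>measure\<close> is 0 on sets of infinite measure and division by 0 gives 0. A lower
  bound \<open>0 < c * (R / r) powr d \<le> vol \<mu> x R / vol \<mu> x r\<close> therefore includes that the balls have
  positive and finite volume.\<close>

definition vol :: "'a::metric_space measure \<Rightarrow> 'a \<Rightarrow> real \<Rightarrow> real" where
  "vol \<mu> x r = measure \<mu> (ball x r)"

section \<open>Scale functions and two-sided estimates\<close>

definition right_inv :: "(real \<Rightarrow> real) \<Rightarrow> real \<Rightarrow> real" where
  "right_inv \<Phi> t = Inf {s. 0 \<le> s \<and> t < \<Phi> s}"

text \<open>Two-sided comparison, with constants that are uniform over the index set. It is stated in
  \<^typ>\<open>ennreal\<close> because both sides may be infinite on the diagonal.\<close>

definition comparable_on :: "'i set \<Rightarrow> ('i \<Rightarrow> ennreal) \<Rightarrow> ('i \<Rightarrow> ennreal) \<Rightarrow> bool" where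
  "comparable_on D h k \<longleftrightarrow>
     (\<exists>c>0::real. \<exists>C>0::real. \<forall>i\<in>D. ennreal c * k i \<le> h i \<and> h i \<le> ennreal C * k i)"

definition jump_kernel_bound ::
  "'a::metric_space measure \<Rightarrow> (real \<Rightarrow> real) \<Rightarrow> real \<Rightarrow> 'a \<Rightarrow> 'a \<Rightarrow> ennreal" where
  "jump_kernel_bound \<mu> \<Phi> t x y =
     min (ennreal (1 / vol \<mu> x (right_inv \<Phi> t)))
         (if dist x y = 0 then \<infinity> else ennreal (t / (vol \<mu> x (dist x y) * \<Phi> (dist x y))))"

section \<open>Subordinators\<close>

definition subordinator :: "'v measure \<Rightarrow> (real \<Rightarrow> 'v \<Rightarrow> real) \<Rightarrow> bool" where
  "subordinator M S \<longleftrightarrow>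
     prob_space M \<and>
     (\<forall>t\<ge>0. S t \<in> borel_measurable M) \<and>
     (AE \<omega> in M. S 0 \<omega> = 0) \<and>
     (\<forall>ts n. 0 \<le> ts 0 \<longrightarrow> incseq ts \<longrightarrow>
        prob_space.indep_vars M (\<lambda>_. borel) (\<lambda>i \<omega>. S (ts (Suc i)) \<omega> - S (ts i) \<omega>) {..<n::nat}) \<and>
     (\<forall>s\<ge>0. \<forall>t\<ge>0. distr M borel (\<lambda>\<omega>. S (s + t) \<omega> - S s \<omega>) = distr M borel (S t)) \<and>
     (AE \<omega> in M. mono_on {0..} (\<lambda>t. S t \<omega>) \<and>
                 (\<forall>t\<ge>0. continuous (at_right t) (\<lambda>u. S u \<omega>)))"

definition subordinator_levy_measure :: "real measure \<Rightarrow> bool" where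
  "subordinator_levy_measure Nu \<longleftrightarrow>
     sets Nu = sets borel \<and> emeasure Nu {..0} = 0 \<and> (\<integral>\<^sup>+x. ennreal (min 1 x) \<partial>Nu) < \<infinity>"

definition laplace_exponent :: "real measure \<Rightarrow> real \<Rightarrow> real" where
  "laplace_exponent Nu l = (LINT x:{0<..}|Nu. 1 - exp (- (l * x)))"

definition driftless_subordinator ::
  "'v measure \<Rightarrow> (real \<Rightarrow> 'v \<Rightarrow> real) \<Rightarrow> real measure \<Rightarrow> bool" where
  "driftless_subordinator M S Nu \<longleftrightarrow>
     subordinator M S \<and> subordinator_levy_measure Nu \<and>
     (\<forall>t\<ge>0. \<forall>l>0. prob_space.expectation M (\<lambda>\<omega>. exp (- (l * S t \<omega>)))
                     = exp (- (t * laplace_exponent Nu l)))"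

text \<open>\<open>pbar r\<close> is the nonnegative bounded smooth version of the density of \<open>S r\<close>; smoothness fixes its
  value at every positive time.\<close>

definition smooth_bounded_densities ::
  "'v measure \<Rightarrow> (real \<Rightarrow> 'v \<Rightarrow> real) \<Rightarrow> (real \<Rightarrow> real \<Rightarrow> real) \<Rightarrow> bool" where
  "smooth_bounded_densities M S pbar \<longleftrightarrow>
     (\<forall>r>0. distributed M lborel (S r) (\<lambda>t. ennreal (pbar r t)) \<and>
            (\<forall>t>0. 0 \<le> pbar r t) \<and>
            (\<exists>B. \<forall>t>0. pbar r t \<le> B) \<and>
            (\<forall>n. (deriv ^^ n) (pbar r) differentiable_on {0<..}))"

section \<open>Semigroups on function spaces\<close>

definition Lp_space :: "'a measure \<Rightarrow> real \<Rightarrow> ('a \<Rightarrow> real) set" where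
  "Lp_space \<mu> p = {f \<in> borel_measurable \<mu>. integrable \<mu> (\<lambda>x. \<bar>f x\<bar> powr p)}"

definition Lp_norm :: "'a measure \<Rightarrow> real \<Rightarrow> ('a \<Rightarrow> real) \<Rightarrow> real" where
  "Lp_norm \<mu> p f = (\<integral>x. \<bar>f x\<bar> powr p \<partial>\<mu>) powr (1 / p)"

definition C_infinity :: "('a::topological_space \<Rightarrow> real) set" where
  "C_infinity = {f. continuous_on UNIV f \<and>
                    (\<forall>\<epsilon>>0. \<exists>K. compact K \<and> (\<forall>x. x \<notin> K \<longrightarrow> \<bar>f x\<bar> < \<epsilon>))}"

definition sup_norm :: "('a \<Rightarrow> real) \<Rightarrow> real" where
  "sup_norm f = (SUP x. \<bar>f x\<bar>)"

text \<open>A function space is given by a set \<open>B\<close> of functions and a seminorm \<open>N\<close> on it; elements are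
  identified when their difference has seminorm 0. This means equality almost everywhere for
  \<^const>\<open>Lp_space\<close> and equality everywhere for \<^const>\<open>C_infinity\<close>.\<close>

definition same_in :: "('a \<Rightarrow> real) set \<Rightarrow> (('a \<Rightarrow> real) \<Rightarrow> real) \<Rightarrow> ('a \<Rightarrow> real) \<Rightarrow> ('a \<Rightarrow> real) \<Rightarrow> bool"
  where "same_in B N f g \<longleftrightarrow> f \<in> B \<and> g \<in> B \<and> N (\<lambda>x. f x - g x) = 0"

definition bounded_C0_semigroup ::
  "('a \<Rightarrow> real) set \<Rightarrow> (('a \<Rightarrow> real) \<Rightarrow> real) \<Rightarrow> (real \<Rightarrow> ('a \<Rightarrow> real) \<Rightarrow> 'a \<Rightarrow> real) \<Rightarrow> bool" where
  "bounded_C0_semigroup B N P \<longleftrightarrow>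
     (\<forall>t\<ge>0. \<forall>f\<in>B. \<forall>g\<in>B. \<forall>a b.
        same_in B N (P t (\<lambda>x. a * f x + b * g x)) (\<lambda>x. a * P t f x + b * P t g x)) \<and>
     (\<forall>f\<in>B. same_in B N (P 0 f) f) \<and>
     (\<forall>s\<ge>0. \<forall>t\<ge>0. \<forall>f\<in>B. same_in B N (P (s + t) f) (P s (P t f))) \<and>
     (\<exists>C. \<forall>t\<ge>0. \<forall>f\<in>B. P t f \<in> B \<and> N (P t f) \<le> C * N f) \<and>
     (\<forall>f\<in>B. ((\<lambda>t. N (\<lambda>x. P t f x - f x)) \<longlongrightarrow> 0) (at_right 0))"

definition generator_domain ::
  "('a \<Rightarrow> real) set \<Rightarrow> (('a \<Rightarrow> real) \<Rightarrow> real) \<Rightarrow> (real \<Rightarrow> ('a \<Rightarrow> real) \<Rightarrow> 'a \<Rightarrow> real) \<Rightarrow> ('a \<Rightarrow> real) set"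
  where
  "generator_domain B N P =
     {f\<in>B. \<exists>g\<in>B. ((\<lambda>t. N (\<lambda>x. (P t f x - f x) / t - g x)) \<longlongrightarrow> 0) (at_right 0)}"

definition has_density_kernel ::
  "('a \<Rightarrow> real) set \<Rightarrow> (('a \<Rightarrow> real) \<Rightarrow> real) \<Rightarrow> (real \<Rightarrow> ('a \<Rightarrow> real) \<Rightarrow> 'a \<Rightarrow> real) \<Rightarrow>
   'a measure \<Rightarrow> (real \<Rightarrow> 'a \<Rightarrow> 'a \<Rightarrow> real) \<Rightarrow> bool" where
  "has_density_kernel B N P \<mu> p0 \<longleftrightarrow>
     (\<forall>t>0. (\<lambda>(x, y). p0 t x y) \<in> borel_measurable (\<mu> \<Otimes>\<^sub>M \<mu>)) \<and>
     (\<forall>x y. (\<lambda>t. p0 t x y) \<in> borel_measurable (restrict_space borel {0<..})) \<and>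
     (\<forall>t>0. \<forall>f\<in>B. same_in B N (P t f) (\<lambda>x. \<integral>y. p0 t x y * f y \<partial>\<mu>))"

section \<open>Pure jump strong Markov processes\<close>

text \<open>The state space is the one-point compactification of the space, whose point at infinity
  \<^const>\<open>None\<close> is the cemetery. Times range over \<open>[0, \<infinity>]\<close> with the convention that the process
  is at the cemetery at time \<open>\<infinity>\<close>.\<close>

definition state_top :: "'a::metric_space option topology" where
  "state_top = Alexandroff_compactification euclidean"

definition state_borel :: "'a::metric_space option measure" where
  "state_borel = sigma UNIV {U. openin state_top U}"

definition ext0 :: "('a \<Rightarrow> real) \<Rightarrow> 'a option \<Rightarrow> real" where
  "ext0 f z = (case z of None \<Rightarrow> 0 | Some x \<Rightarrow> f x)"

definition strong_markov_process ::
  "'w measure \<Rightarrow> (ennreal \<Rightarrow> 'w measure) \<Rightarrow> ('a::metric_space option \<Rightarrow> 'w measure) \<Rightarrow>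
   (ennreal \<Rightarrow> 'w \<Rightarrow> 'a option) \<Rightarrow> bool" where
  "strong_markov_process M F Px X \<longleftrightarrow>
     \<comment> \<open>right-continuous filtration, adapted process\<close>
     filtration (space M) F \<and>
     (\<forall>t. sets (F t) \<subseteq> sets M) \<and>
     (\<forall>t<\<infinity>. sets (F t) = (\<Inter>s\<in>{t<..}. sets (F s))) \<and>
     (\<forall>t. X t \<in> F t \<rightarrow>\<^sub>M state_borel) \<and>
     \<comment> \<open>laws, measurable in the starting point\<close>
     (\<forall>z. prob_space (Px z) \<and> sets (Px z) = sets M) \<and>
     (\<forall>t. (\<lambda>z. distr (Px z) state_borel (X t)) \<in> state_borel \<rightarrow>\<^sub>M prob_algebra state_borel) \<and>
     (\<forall>z. AE \<omega> in Px z. X 0 \<omega> = z) \<and>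
     \<comment> \<open>absorbing cemetery, right-continuous paths with left limits\<close>
     (\<forall>\<omega>\<in>space M. X \<infinity> \<omega> = None \<and> (\<forall>s t. s \<le> t \<longrightarrow> X s \<omega> = None \<longrightarrow> X t \<omega> = None)) \<and>
     (\<forall>\<omega>\<in>space M. \<forall>t<\<infinity>. limitin state_top (\<lambda>s. X s \<omega>) (X t \<omega>) (at_right t)) \<and>
     (\<forall>\<omega>\<in>space M. \<forall>t. 0 < t \<longrightarrow> t < \<infinity> \<longrightarrow> (\<exists>z. limitin state_top (\<lambda>s. X s \<omega>) z (at_left t))) \<and>
     \<comment> \<open>strong Markov property\<close>
     (\<forall>z T. stopping_time F T \<longrightarrow>
        (\<forall>A\<in>sets (filtration.pre_sigma (space M) F T). \<forall>s. \<forall>C\<in>sets state_borel.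
           emeasure (Px z) {\<omega>\<in>A. X (T \<omega> + s) \<omega> \<in> C}
           = (\<integral>\<^sup>+\<omega>\<in>A. emeasure (Px (X (T \<omega>) \<omega>)) {\<omega>'\<in>space M. X s \<omega>' \<in> C} \<partial>Px z)))"

definition semigroup_of_process ::
  "('a \<Rightarrow> real) set \<Rightarrow> (('a \<Rightarrow> real) \<Rightarrow> real) \<Rightarrow> (real \<Rightarrow> ('a \<Rightarrow> real) \<Rightarrow> 'a \<Rightarrow> real) \<Rightarrow>
   ('a option \<Rightarrow> 'w measure) \<Rightarrow> (ennreal \<Rightarrow> 'w \<Rightarrow> 'a option) \<Rightarrow> bool" where
  "semigroup_of_process B N P Px X \<longleftrightarrow>
     (\<forall>t\<ge>0. \<forall>f\<in>B. same_in B N (P t f) (\<lambda>x. \<integral>\<omega>. ext0 f (X (ennreal t) \<omega>) \<partial>Px (Some x)))"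

text \<open>Pure jump means that there is no diffusion part: for \<open>f\<close> in the domain of the generator,
  \<open>f (X t)\<close> is the sum of a martingale and a continuous process of finite variation, and the martingale
  has to be purely discontinuous. Equivalently, the quadratic variation of \<open>f (X t)\<close>, the limit in
  probability of the sums of squared increments, is the sum of the squared jumps.\<close>

definition sq_increments :: "('a \<Rightarrow> real) \<Rightarrow> (ennreal \<Rightarrow> 'w \<Rightarrow> 'a option) \<Rightarrow> real \<Rightarrow> nat \<Rightarrow> 'w \<Rightarrow> real" where
  "sq_increments f X T n \<omega> =
     (\<Sum>i<n. (ext0 f (X (ennreal (T * real (Suc i) / real n)) \<omega>)
               - ext0 f (X (ennreal (T * real i / real n)) \<omega>))\<^sup>2)"

definition sq_jumps :: "('a \<Rightarrow> real) \<Rightarrow> (ennreal \<Rightarrow> 'w \<Rightarrow> 'a option) \<Rightarrow> real \<Rightarrow> 'w \<Rightarrow> real" where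
  "sq_jumps f X T \<omega> =
     (\<Sum>\<^sub>\<infinity>s\<in>{0<..T}. (ext0 f (X (ennreal s) \<omega>)
                     - Lim (at_left s) (\<lambda>u. ext0 f (X (ennreal u) \<omega>)))\<^sup>2)"

definition pure_jump ::
  "('a::metric_space \<Rightarrow> real) set \<Rightarrow> (('a \<Rightarrow> real) \<Rightarrow> real) \<Rightarrow> (real \<Rightarrow> ('a \<Rightarrow> real) \<Rightarrow> 'a \<Rightarrow> real) \<Rightarrow>
   'a measure \<Rightarrow> ('a option \<Rightarrow> 'w measure) \<Rightarrow> (ennreal \<Rightarrow> 'w \<Rightarrow> 'a option) \<Rightarrow> bool" where
  "pure_jump B N P \<mu> Px X \<longleftrightarrow>
     (\<forall>f \<in> generator_domain B N P \<inter> C_infinity. AE x in \<mu>. \<forall>T>0. \<forall>\<epsilon>>0.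
        (\<lambda>n. measure (Px (Some x))
               {\<omega> \<in> space (Px (Some x)). \<bar>sq_increments f X T n \<omega> - sq_jumps f X T \<omega>\<bar> > \<epsilon>})
        \<longlonglongrightarrow> 0)"

section \<open>The kernel of the statement\<close>

definition q_kernel ::
  "(real \<Rightarrow> 'a \<Rightarrow> 'a \<Rightarrow> real) \<Rightarrow> (real \<Rightarrow> real \<Rightarrow> real) \<Rightarrow> real \<Rightarrow> 'a \<Rightarrow> 'a \<Rightarrow> ennreal" where
  "q_kernel p0 pbar t x y = (\<integral>\<^sup>+r\<in>{0<..}. ennreal (p0 r x y * pbar r t) \<partial>lborel)"

end

theory Submission
  imports Defs
begin

text \<open>
  Write \<open>w z = z \<nu>(z)\<close>. Differentiating \<open>E (exp (- \<lambda> S_r)) = exp (- r \<phi>(\<lambda>))\<close> in \<open>\<lambda>\<close> gives, by uniqueness of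
  Laplace transforms, \<open>t p(r,t) = r \<integral>\<^sub>0\<^sup>t w(s) p(r,t - s) ds\<close> for the density \<open>p(r,\<cdot>)\<close> of \<open>S_r\<close>. Let
  \<open>x = r \<phi>(1/t)\<close>. Since \<open>w\<close> decreases and is comparable to \<open>\<phi>(1/t)\<close>, the part \<open>s > \<delta>\<close> of the integral is
  controlled by \<open>P(S_r \<le> t) \<le> exp (1 - x)\<close>, and the part \<open>s \<le> \<delta>\<close> by a small multiple of \<open>sup (s p(r,s))\<close>, so
  that this supremum absorbs itself: \<open>t p(r,t) \<le> C min(x, x\<^sup>-\<^sup>4)\<close>. Conversely \<open>t p(r,t) \<ge> c x\<close> for small \<open>x\<close>,
  because then \<open>P(S_r \<le> t) \<ge> 1/2\<close>. With \<open>T = 1/\<phi>(1/t)\<close> and \<open>a = \<Phi>(d(x,y))\<close>, both estimates of \<open>q\<close> follow by splitting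
  the mixing integral over \<open>r\<close> at \<open>a\<close> and \<open>T\<close>.
\<close>

text \<open>The absorption \<open>H \<le> C + H / 2\<close> says something only for a finite
  supremum. It is therefore run on a bounded interval of times, where the boundedness of the density
  gives finiteness; the outcome \<open>2 * C\<close> depends neither on that interval nor on
  \<open>r\<close>. The convolution identity comes from uniqueness of transforms, so it holds almost
  everywhere only: every estimate is first obtained at such times and then extended by continuity of
  the density. The exponent 4 is dictated by convergence: the comparison kernel can grow linearly in
  \<open>r\<close>, and beyond \<open>T\<close> the product of the linear factor with the density
  bound must still be integrable. The lower bound of the density for \<open>r \<le> T / 8\<close> is
  enough because monotonicity of \<open>1 / V(x, \<Phi>^(-1)(r))\<close> lets this range carry a
  fixed share of the comparison quantity. The integral in (i) runs up to \<open>2 * T\<close> rather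
  than \<open>T\<close> so that it does not degenerate at \<open>a = T\<close>, where (i) and (ii)
  meet.\<close>

section \<open>Uniqueness and derivatives of Laplace transforms\<close>

text \<open>Both characteristic functions have the same Taylor polynomials. Since the absolute
  moments are at most 1, the error at degree \<open>n\<close> is at most
  \<open>2 * \<bar>t\<bar>^n / fact n\<close>, which tends to 0 for every \<open>t\<close>.\<close>

lemma real_distribution_moments_unique:
  fixes M1 M2 :: "real measure"
  assumes "real_distribution M1" "real_distribution M2"
    and bnd: "AE x in M1. \<bar>x\<bar> \<le> 1" "AE x in M2. \<bar>x\<bar> \<le> 1"
    and mom: "\<And>k. integral\<^sup>L M1 (\<lambda>x. x ^ k) = integral\<^sup>L M2 (\<lambda>x. x ^ k)"
  shows "M1 = M2"
proof (rule Levy_uniqueness[OF assms(1,2)], rule ext)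
  fix t :: real
  interpret M1: real_distribution M1 by fact
  interpret M2: real_distribution M2 by fact
  have int: "integrable M (\<lambda>x. x ^ k)" "integral\<^sup>L M (\<lambda>x. \<bar>x\<bar> ^ k) \<le> 1"
    if "real_distribution M" "AE x in M. \<bar>x\<bar> \<le> 1" for M :: "real measure" and k
  proof -
    interpret M: real_distribution M by fact
    have b: "AE x in M. \<bar>x\<bar> ^ k \<le> 1" using that(2) by eventually_elim (simp add: power_le_one)
    show "integrable M (\<lambda>x. x ^ k)"
      using b by (intro M.integrable_const_bound[where B = 1]) (auto simp: power_abs)
    then have "integrable M (\<lambda>x. \<bar>x\<bar> ^ k)" by (simp add: integrable_abs power_abs[symmetric])
    then have "integral\<^sup>L M (\<lambda>x. \<bar>x\<bar> ^ k) \<le> integral\<^sup>L M (\<lambda>x. 1)"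
      using b by (intro integral_mono_AE) auto
    then show "integral\<^sup>L M (\<lambda>x. \<bar>x\<bar> ^ k) \<le> 1" using M.prob_space by simp
  qed
  have "cmod (char M1 t - char M2 t) \<le> 4 * (\<bar>t\<bar> ^ n / fact n)" for n
  proof -
    define s where "s = (\<Sum>k \<le> n. ((\<i> * t)^k / fact k) * M1.expectation (\<lambda>x. x^k))"
    have s2: "s = (\<Sum>k \<le> n. ((\<i> * t)^k / fact k) * M2.expectation (\<lambda>x. x^k))"
      unfolding s_def mom ..
    have "cmod (char M1 t - s) \<le> (2*\<bar>t\<bar>^n / fact n) * M1.expectation (\<lambda>x. \<bar>x\<bar>^n)"
      unfolding s_def using int[OF assms(1) bnd(1)] by (intro M1.char_approx1) auto
    also have "\<dots> \<le> (2*\<bar>t\<bar>^n / fact n) * 1"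
      using int[OF assms(1) bnd(1)] by (intro mult_left_mono) auto
    finally have 1: "cmod (char M1 t - s) \<le> 2 * (\<bar>t\<bar>^n / fact n)" by simp
    have "cmod (char M2 t - s) \<le> (2*\<bar>t\<bar>^n / fact n) * M2.expectation (\<lambda>x. \<bar>x\<bar>^n)"
      unfolding s2 using int[OF assms(2) bnd(2)] by (intro M2.char_approx1) auto
    also have "\<dots> \<le> (2*\<bar>t\<bar>^n / fact n) * 1"
      using int[OF assms(2) bnd(2)] by (intro mult_left_mono) auto
    finally have 2: "cmod (char M2 t - s) \<le> 2 * (\<bar>t\<bar>^n / fact n)" by simp
    show ?thesis using norm_triangle_ineq4[of "char M1 t - s" "char M2 t - s"] 1 2 by simp
  qed
  moreover have "(\<lambda>n. 4 * (\<bar>t\<bar> ^ n / fact n)) \<longlonglongrightarrow> 4 * 0"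
    using summable_LIMSEQ_zero[OF summable_exp[of "\<bar>t\<bar>"]]
    by (intro tendsto_mult tendsto_const) (simp add: field_simps)
  ultimately have "cmod (char M1 t - char M2 t) \<le> 4 * 0"
    by (intro LIMSEQ_le_const[where X = "\<lambda>n. 4 * (\<bar>t\<bar> ^ n / fact n)"]) auto
  then show "char M1 t = char M2 t" by simp
qed

lemma laplace_transform_unique_prob:
  fixes f g :: "real \<Rightarrow> ennreal"
  assumes [measurable]: "f \<in> borel_measurable borel" "g \<in> borel_measurable borel"
    and supp: "\<And>t. t \<le> 0 \<Longrightarrow> f t = 0" "\<And>t. t \<le> 0 \<Longrightarrow> g t = 0"
    and one: "(\<integral>\<^sup>+t. f t \<partial>lborel) = 1"
    and lap: "\<And>k::nat. (\<integral>\<^sup>+t. f t * ennreal (exp (- (real k * t))) \<partial>lborel) = (\<integral>\<^sup>+t. g t * ennreal (exp (- (real k * t))) \<partial>lborel)"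
  shows "AE t in lborel. f t = g t"
proof -
  \<comment> \<open>The substitution \<open>u = exp (- t)\<close> turns values of the transform at integers into moments on \<open>[0,1]\<close>.\<close>
  define X where "X t = exp (- max 0 t)" for t :: real
  have [measurable]: "X \<in> borel_measurable borel" unfolding X_def by measurable
  have X: "0 < X t" "X t \<le> 1" for t by (auto simp: X_def)
  have main: "real_distribution (distr (density lborel h) borel X)"
    "AE x in distr (density lborel h) borel X. \<bar>x\<bar> \<le> 1"
    "\<And>k. integral\<^sup>L (distr (density lborel h) borel X) (\<lambda>x. x ^ k) = enn2real (\<integral>\<^sup>+t. h t * ennreal (exp (- (real k * t))) \<partial>lborel)"
    "distr (distr (density lborel h) borel X) borel (\<lambda>x. - ln x) = density lborel h"
    if [measurable]: "h \<in> borel_measurable borel" and supp: "\<And>t. t \<le> 0 \<Longrightarrow> h t = 0" and one: "(\<integral>\<^sup>+t. h t \<partial>lborel) = 1"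
    for h :: "real \<Rightarrow> ennreal"
  proof -
    have prob: "prob_space (density lborel h)"
      by (rule prob_spaceI) (simp add: emeasure_density one)
    interpret prob_space "density lborel h" by fact
    show "real_distribution (distr (density lborel h) borel X)"
      by (intro real_distribution_distr) simp
    show "AE x in distr (density lborel h) borel X. \<bar>x\<bar> \<le> 1"
      using X by (subst AE_distr_iff) (auto simp: less_imp_le)
    have pos: "AE t in density lborel h. t > 0"
      by (subst AE_density) (auto intro!: AE_I2 simp: not_le[symmetric] supp)
    show "integral\<^sup>L (distr (density lborel h) borel X) (\<lambda>x. x ^ k) = enn2real (\<integral>\<^sup>+t. h t * ennreal (exp (- (real k * t))) \<partial>lborel)" for k
    proof -
      have "integral\<^sup>L (distr (density lborel h) borel X) (\<lambda>x. x ^ k) = (\<integral>t. X t ^ k \<partial>density lborel h)"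
        by (subst integral_distr) auto
      also have "\<dots> = enn2real (\<integral>\<^sup>+t. ennreal (X t ^ k) \<partial>density lborel h)"
        using X by (intro integral_eq_nn_integral) (auto simp: less_imp_le)
      also have "(\<integral>\<^sup>+t. ennreal (X t ^ k) \<partial>density lborel h) = (\<integral>\<^sup>+t. h t * ennreal (X t ^ k) \<partial>lborel)"
        by (intro nn_integral_density) auto
      also have "\<dots> = (\<integral>\<^sup>+t. h t * ennreal (exp (- (real k * t))) \<partial>lborel)"
      proof (intro nn_integral_cong)
        fix t :: real
        show "h t * ennreal (X t ^ k) = h t * ennreal (exp (- (real k * t)))"
          by (cases "t > 0") (simp_all add: X_def supp flip: exp_of_nat_mult)
      qed
      finally show ?thesis .
    qed
    \<comment> \<open>\<open>- ln\<close> undoes \<open>X\<close> on the positive axis, where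
      \<open>density lborel h\<close> has all its mass. Hence the pushforward under \<open>X\<close>
      determines the density.\<close>
    have "distr (distr (density lborel h) borel X) borel (\<lambda>x. - ln x) = distr (density lborel h) borel (\<lambda>t. max 0 t)"
      by (subst distr_distr) (auto simp: comp_def X_def)
    also have "\<dots> = distr (density lborel h) (density lborel h) (\<lambda>t. t)"
      using pos by (intro distr_cong_AE) auto
    finally show "distr (distr (density lborel h) borel X) borel (\<lambda>x. - ln x) = density lborel h" by simp
  qed
  have oneg: "(\<integral>\<^sup>+t. g t \<partial>lborel) = 1" using lap[of 0] one by simp
  have F: "real_distribution (distr (density lborel f) borel X)"
    "AE x in distr (density lborel f) borel X. \<bar>x\<bar> \<le> 1"
    and G: "real_distribution (distr (density lborel g) borel X)"
    "AE x in distr (density lborel g) borel X. \<bar>x\<bar> \<le> 1"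
    using main(1,2)[OF assms(1) supp(1) one] main(1,2)[OF assms(2) supp(2) oneg] by blast+
  note F = F main(3,4)[OF assms(1) supp(1) one] and G = G main(3,4)[OF assms(2) supp(2) oneg]
  have "distr (density lborel f) borel X = distr (density lborel g) borel X"
  proof (rule real_distribution_moments_unique[OF F(1) G(1) F(2) G(2)])
    show "integral\<^sup>L (distr (density lborel f) borel X) (\<lambda>x. x ^ k) = integral\<^sup>L (distr (density lborel g) borel X) (\<lambda>x. x ^ k)" for k
      by (subst F(3), assumption, subst G(3), assumption, subst lap, rule refl)
  qed
  then have "density lborel f = density lborel g"
    using F(4) G(4) by metis
  then show ?thesis by (intro sigma_finite_measure.density_unique[OF sigma_finite_lborel]) auto
qed

text \<open>The functions need not be integrable, since the transform is finite only for
  \<open>l > 0\<close>. The weight \<open>exp (- t) / c\<close> makes \<open>f\<close> a probability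
  density and shifts the transform from \<open>k\<close> to \<open>1 + k\<close>, where equality is
  assumed. The weight is positive and can be divided out at the end.\<close>

lemma laplace_transform_unique:
  fixes f g :: "real \<Rightarrow> ennreal"
  assumes [measurable]: "f \<in> borel_measurable borel" "g \<in> borel_measurable borel"
    and supp: "\<And>t. t \<le> 0 \<Longrightarrow> f t = 0" "\<And>t. t \<le> 0 \<Longrightarrow> g t = 0"
    and lap: "\<And>l. l > 0 \<Longrightarrow> (\<integral>\<^sup>+t. f t * ennreal (exp (- (l * t))) \<partial>lborel) = (\<integral>\<^sup>+t. g t * ennreal (exp (- (l * t))) \<partial>lborel)"
    and fin: "\<And>l. l > 0 \<Longrightarrow> (\<integral>\<^sup>+t. f t * ennreal (exp (- (l * t))) \<partial>lborel) < \<infinity>"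
  shows "AE t in lborel. f t = g t"
proof -
  define c where "c = (\<integral>\<^sup>+t. f t * ennreal (exp (- t)) \<partial>lborel)"
  have c_g: "c = (\<integral>\<^sup>+t. g t * ennreal (exp (- t)) \<partial>lborel)" using lap[of 1] by (simp add: c_def)
  have c_fin: "c < \<infinity>" using fin[of 1] by (simp add: c_def)
  show ?thesis
  proof (cases "c = 0")
    case True
    have "AE t in lborel. f t * ennreal (exp (- t)) = 0" "AE t in lborel. g t * ennreal (exp (- t)) = 0"
      using True c_g by (subst nn_integral_0_iff_AE[symmetric]; simp add: c_def)+
    then show ?thesis by eventually_elim auto
  next
    case False
    then have c: "c > 0" by (simp add: zero_less_iff_neq_zero)
    have cc: "c / c = 1" using c c_fin by (intro ennreal_divide_self) auto
    have eq: "u t * ennreal (exp (- t)) / c * ennreal (exp (- (real k * t))) = u t * ennreal (exp (- ((1 + real k) * t))) / c"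
      for k t and u :: "real \<Rightarrow> ennreal"
    proof -
      have "exp (- ((1 + real k) * t)) = exp (- t) * exp (- (real k * t))"
        by (simp add: exp_add[symmetric] algebra_simps)
      then show ?thesis by (simp add: divide_ennreal_def ennreal_mult mult_ac)
    qed
    have "AE t in lborel. f t * ennreal (exp (- t)) / c = g t * ennreal (exp (- t)) / c"
    proof (rule laplace_transform_unique_prob)
      show "(\<integral>\<^sup>+t. f t * ennreal (exp (- t)) / c \<partial>lborel) = 1"
        by (subst nn_integral_divide) (auto simp: c_def[symmetric] cc)
      fix k :: nat
      show "(\<integral>\<^sup>+t. f t * ennreal (exp (- t)) / c * ennreal (exp (- (real k * t))) \<partial>lborel)
          = (\<integral>\<^sup>+t. g t * ennreal (exp (- t)) / c * ennreal (exp (- (real k * t))) \<partial>lborel)"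
        unfolding eq by (subst (1 2) nn_integral_divide) (auto simp: lap)
    qed (auto simp: supp)
    then show ?thesis
    proof eventually_elim
      case (elim t)
      have *: "u * ennreal (exp (- t)) / c * (ennreal (exp t) * c) = u" for u
      proof -
        have "u * ennreal (exp (- t)) / c * (ennreal (exp t) * c) = u * (ennreal (exp (- t)) * ennreal (exp t)) * (c / c)"
          by (simp add: divide_ennreal_def mult_ac)
        also have "ennreal (exp (- t)) * ennreal (exp t) = 1"
          by (subst ennreal_mult[symmetric]) (auto simp: exp_minus)
        finally show ?thesis by (simp add: cc)
      qed
      show ?case using arg_cong[OF elim, of "\<lambda>u. u * (ennreal (exp t) * c)"] by (simp only: *)
    qed
  qed
qed

text \<open>Differentiation under the integral sign. The dominating function \<open>W\<close> is
  integrable because \<open>u * exp (- u) \<le> 1 - exp (- u)\<close> bounds it by a multiple of the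
  integrand of \<open>\<psi> (l / 2)\<close>. The lemma serves twice: for \<phi> with the Levy
  density as \<open>v\<close>, and for \<open>1 - exp (- r \<phi>)\<close> with the density of
  \<open>S_r\<close> as \<open>v\<close>.\<close>

lemma DERIV_nn_integral_1_minus_exp:
  fixes v \<psi> :: "real \<Rightarrow> real"
  assumes [measurable]: "v \<in> borel_measurable borel"
    and v: "\<And>s. v s \<ge> 0" "\<And>s. s \<le> 0 \<Longrightarrow> v s = 0"
    and psi: "\<And>l. l > 0 \<Longrightarrow> (\<integral>\<^sup>+s. ennreal ((1 - exp (- (l * s))) * v s) \<partial>lborel) = ennreal (\<psi> l)"
      "\<And>l. l > 0 \<Longrightarrow> \<psi> l \<ge> 0"
    and l: "l > 0"
  shows "\<exists>D\<ge>0. (\<psi> has_real_derivative D) (at l) \<and> (\<integral>\<^sup>+s. ennreal (s * v s * exp (- (l * s))) \<partial>lborel) = ennreal D"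
proof -
  have nn: "(1 - exp (- (l * s))) * v s \<ge> 0" if "l > 0" for l s
    using that v[of s] by (cases "s \<le> 0") auto
  have int: "integrable lborel (\<lambda>s. (1 - exp (- (l * s))) * v s)" "integral\<^sup>L lborel (\<lambda>s. (1 - exp (- (l * s))) * v s) = \<psi> l"
    if "l > 0" for l
  proof -
    show "integrable lborel (\<lambda>s. (1 - exp (- (l * s))) * v s)"
      using psi(1)[OF that] nn[OF that] by (intro integrableI_nonneg) auto
    show "integral\<^sup>L lborel (\<lambda>s. (1 - exp (- (l * s))) * v s) = \<psi> l"
      using psi(1)[OF that] psi(2)[OF that] nn[OF that] by (subst integral_eq_nn_integral) auto
  qed
  define W where "W s = s * v s * exp (- (l / 2 * s))" for s
  have [measurable]: "W \<in> borel_measurable borel" unfolding W_def by measurable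
  have W: "W s \<ge> 0" for s using v[of s] by (cases "s \<le> 0") (auto simp: W_def)
  have Wint: "integrable lborel W"
  proof (rule Bochner_Integration.integrable_bound)
    show "integrable lborel (\<lambda>s. 4 / l * ((1 - exp (- (l/2 * s))) * v s))"
      using int(1)[of "l/2"] l by simp
    show "AE s in lborel. norm (W s) \<le> norm (4 / l * ((1 - exp (- (l/2 * s))) * v s))"
    proof (intro AE_I2)
      fix s :: real
      show "norm (W s) \<le> norm (4 / l * ((1 - exp (- (l/2 * s))) * v s))"
      proof (cases "s > 0")
        case True
        have "1 + l / 2 * s \<le> exp (l / 2 * s)" by (rule exp_ge_add_one_self)
        then have "(1 + l / 2 * s) * exp (- (l/2 * s)) \<le> exp (l / 2 * s) * exp (- (l/2 * s))"
          by (intro mult_right_mono) auto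
        then have "s * exp (- (l/2 * s)) \<le> 4 / l * (1 - exp (- (l/2 * s)))"
          using l by (simp add: field_simps flip: exp_add) (smt (verit) True exp_le_one_iff mult_pos_pos)
        then have le: "s * exp (- (l/2 * s)) * v s \<le> 4 / l * (1 - exp (- (l/2 * s))) * v s"
          using v by (intro mult_right_mono) auto
        have "norm (W s) = W s" using W[of s] by simp
        also have "\<dots> \<le> 4 / l * ((1 - exp (- (l/2 * s))) * v s)"
          using le by (simp add: W_def mult_ac)
        also have "\<dots> \<le> norm (4 / l * ((1 - exp (- (l/2 * s))) * v s))"
          unfolding real_norm_def by (rule abs_ge_self)
        finally show ?thesis .
      qed (simp add: W_def v)
    qed
  qed simp
  define D where "D = integral\<^sup>L lborel (\<lambda>s. s * v s * exp (- (l * s)))"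
  \<comment> \<open>Staying above \<open>l / 2\<close> keeps the difference quotients below
    \<open>W\<close>; as this is a neighbourhood of \<open>l\<close>, the restriction disappears
    later. Sequences are used because dominated convergence is a statement about them.\<close>
  have lim: "((\<lambda>y. (\<psi> y - \<psi> l) / (y - l)) \<longlongrightarrow> D) (at l within {l/2<..})"
    unfolding tendsto_at_iff_sequentially
  proof (intro allI impI)
    fix X :: "nat \<Rightarrow> real" assume X: "\<forall>i. X i \<in> {l/2<..} - {l}" "X \<longlonglongrightarrow> l"
    have XL: "filterlim X (at l) sequentially" using X by (auto simp: filterlim_at)
    have "(\<lambda>i. integral\<^sup>L lborel (\<lambda>s. (exp (- (l * s)) - exp (- (X i * s))) / (X i - l) * v s)) \<longlonglongrightarrow> D"
      unfolding D_def
    proof (rule integral_dominated_convergence[where w = W])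
      show "AE s in lborel. (\<lambda>i. (exp (- (l * s)) - exp (- (X i * s))) / (X i - l) * v s) \<longlonglongrightarrow> s * v s * exp (- (l * s))"
      proof (intro AE_I2)
        fix s :: real
        have "((\<lambda>y. - exp (- (y * s))) has_real_derivative s * exp (- (l * s))) (at l)"
          by (auto intro!: derivative_eq_intros)
        then have "((\<lambda>y. (exp (- (l * s)) - exp (- (y * s))) / (y - l)) \<longlongrightarrow> s * exp (- (l * s))) (at l)"
          by (simp add: has_field_derivative_iff)
        then have "(\<lambda>i. (exp (- (l * s)) - exp (- (X i * s))) / (X i - l)) \<longlonglongrightarrow> s * exp (- (l * s))"
          by (rule filterlim_compose[OF _ XL])
        then have "(\<lambda>i. (exp (- (l * s)) - exp (- (X i * s))) / (X i - l) * v s) \<longlonglongrightarrow> s * exp (- (l * s)) * v s"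
          by (intro tendsto_mult tendsto_const)
        moreover have "s * exp (- (l * s)) * v s = s * v s * exp (- (l * s))" by simp
        ultimately show "(\<lambda>i. (exp (- (l * s)) - exp (- (X i * s))) / (X i - l) * v s) \<longlonglongrightarrow> s * v s * exp (- (l * s))"
          by simp
      qed
      fix i
      show "AE s in lborel. norm ((exp (- (l * s)) - exp (- (X i * s))) / (X i - l) * v s) \<le> W s"
      proof (intro AE_I2)
        fix s :: real
        show "norm ((exp (- (l * s)) - exp (- (X i * s))) / (X i - l) * v s) \<le> W s"
        proof (cases "s > 0")
          case True
          have "norm (exp (- (X i * s)) - exp (- (l * s))) \<le> s * exp (- (l / 2 * s)) * norm (X i - l)"
          proof (rule field_differentiable_bound[of "{l/2..}" "\<lambda>y. exp (- (y * s))" "\<lambda>y. - (s * exp (- (y * s)))"])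
            fix z assume "z \<in> {l/2..}"
            then show "norm (- (s * exp (- (z * s)))) \<le> s * exp (- (l / 2 * s))" using True
              by (simp add: abs_mult)
          next
            fix z assume "z \<in> {l/2..}"
            show "((\<lambda>y. exp (- (y * s))) has_field_derivative - (s * exp (- (z * s)))) (at z within {l / 2..})"
              by (auto intro!: derivative_eq_intros)
          qed (use X l in \<open>auto simp: less_imp_le\<close>)
          then have "\<bar>exp (- (l * s)) - exp (- (X i * s))\<bar> / \<bar>X i - l\<bar> \<le> s * exp (- (l / 2 * s))"
            using X(1)[rule_format, of i] by (simp add: pos_divide_le_eq abs_minus_commute)
          then have "\<bar>exp (- (l * s)) - exp (- (X i * s))\<bar> / \<bar>X i - l\<bar> * v s \<le> s * exp (- (l / 2 * s)) * v s"
            using v by (intro mult_right_mono) auto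
          then show ?thesis using v by (simp add: W_def abs_mult mult_ac)
        qed (auto simp: W_def v)
      qed
    qed (auto simp: Wint)
    moreover have "integral\<^sup>L lborel (\<lambda>s. (exp (- (l * s)) - exp (- (X i * s))) / (X i - l) * v s) = (\<psi> (X i) - \<psi> l) / (X i - l)" for i
    proof -
      have Xi: "X i > 0" using X(1)[rule_format, of i] l by auto
      have "(\<lambda>s. (exp (- (l * s)) - exp (- (X i * s))) / (X i - l) * v s)
         = (\<lambda>s. ((1 - exp (- (X i * s))) * v s - (1 - exp (- (l * s))) * v s) / (X i - l))"
        by (auto simp: algebra_simps diff_divide_distrib)
      then show ?thesis using int[OF l] int[OF Xi] by simp
    qed
    ultimately show "((\<lambda>y. (\<psi> y - \<psi> l) / (y - l)) \<circ> X) \<longlonglongrightarrow> D"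
      unfolding comp_def by (simp only:)
  qed
  have "at l within {l/2<..} = at l" using l by (intro at_within_open) auto
  with lim have der: "(\<psi> has_real_derivative D) (at l)" by (simp add: has_field_derivative_iff)
  have nn': "s * v s * exp (- (l * s)) \<ge> 0" for s using v[of s] by (cases "s \<le> 0") auto
  have "integrable lborel (\<lambda>s. s * v s * exp (- (l * s)))"
  proof (rule Bochner_Integration.integrable_bound[OF Wint])
    show "AE s in lborel. norm (s * v s * exp (- (l * s))) \<le> norm (W s)"
    proof (intro AE_I2)
      fix s
      show "norm (s * v s * exp (- (l * s))) \<le> norm (W s)"
        using v[of s] l by (cases "s \<le> 0") (auto simp: W_def abs_mult intro!: mult_left_mono)
    qed
  qed auto
  then have "(\<integral>\<^sup>+s. ennreal (s * v s * exp (- (l * s))) \<partial>lborel) = ennreal D"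
    unfolding D_def using nn' by (intro nn_integral_eq_integral) auto
  moreover have "D \<ge> 0" unfolding D_def using nn' by (intro Bochner_Integration.integral_nonneg) auto
  ultimately show ?thesis using der by blast
qed

section \<open>Densities of a subordinator with scaling exponent\<close>

text \<open>The set where the inequality fails is open and null, hence empty. This upgrades
  consequences of the almost everywhere identity for the density to all times.\<close>

lemma AE_le_imp_le_on_open:
  fixes f g :: "real \<Rightarrow> real"
  assumes "open U" "continuous_on U f" "continuous_on U g"
    and ae: "AE t in lborel. t \<in> U \<longrightarrow> f t \<le> g t" and t: "t \<in> U"
  shows "f t \<le> g t"
proof (rule ccontr)
  assume less: "\<not> f t \<le> g t"
  define S where "S = {t\<in>U. f t - g t > 0}"
  have "open (U \<inter> (\<lambda>t. f t - g t) -` {0<..})"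
    using assms by (intro continuous_open_preimage) (auto intro: continuous_intros)
  also have "U \<inter> (\<lambda>t. f t - g t) -` {0<..} = S" by (auto simp: S_def)
  finally have S: "open S" .
  have "AE t in lborel. t \<notin> S" using ae by eventually_elim (auto simp: S_def)
  then have "S \<in> null_sets lborel" using S by (subst AE_iff_null_sets) auto
  then have "negligible S" by (simp add: negligible_iff_null_sets null_sets_completionI)
  then have "S = {}" using S open_not_negligible by blast
  then show False using t less by (auto simp: S_def)
qed

lemma ex_powr_le:
  fixes a e :: real
  assumes "a > 0" "e > 0"
  obtains d where "0 < d" "d \<le> 1" "d powr a \<le> e"
proof
  define d where "d = min 1 (e powr (1 / a))"
  show "0 < d" "d \<le> 1" using assms by (auto simp: d_def)
  have "d powr a \<le> (e powr (1 / a)) powr a"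
    using assms by (intro powr_mono2) (auto simp: d_def)
  also have "\<dots> = e" using assms by (simp add: powr_powr)
  finally show "d powr a \<le> e" .
qed

lemma ex_max_powr_exp_bound:
  fixes b :: real
  obtains C where "C > 0" "\<And>x. x \<ge> 0 \<Longrightarrow> max 1 x powr b * exp (- x) \<le> C"
proof -
  obtain n :: nat where n: "b \<le> real n" using real_arch_simple by blast
  show ?thesis
  proof (rule that[of "fact n * exp 1"])
    fix x :: real assume x: "x \<ge> 0"
    define y where "y = max 1 x"
    have y: "y \<ge> 1" "y \<le> 1 + x" using x by (auto simp: y_def)
    have "y powr b \<le> y powr real n" using y n by (intro powr_mono) auto
    also have "\<dots> = y ^ n" using y by (simp add: powr_realpow)
    also have "\<dots> \<le> fact n * exp y"
    proof -
      have "sum (\<lambda>k. y ^ k /\<^sub>R fact k) {n} \<le> exp y"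
        using y sum_le_suminf[of "\<lambda>k. y ^ k /\<^sub>R fact k" "{n}"] summable_exp_generic[of y]
        by (simp add: exp_def)
      then show ?thesis by (simp add: field_simps)
    qed
    also have "\<dots> \<le> fact n * exp (1 + x)" using y by simp
    finally have "y powr b * exp (- x) \<le> fact n * exp (1 + x) * exp (- x)"
      by (intro mult_right_mono) auto
    also have "\<dots> = fact n * exp 1" by (simp add: exp_add exp_minus)
    finally show "max 1 x powr b * exp (- x) \<le> fact n * exp 1" by (simp add: y_def)
  qed simp
qed

lemma exp_minus_le_inverse: "u \<ge> 0 \<Longrightarrow> exp (- u) \<le> 1 / (1 + u)" for u :: real
  using exp_ge_add_one_self[of u] by (simp add: exp_minus field_simps)

lemma half_le_1_minus_exp:
  fixes u :: real
  assumes "0 \<le> u" "u \<le> 1"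
  shows "u / 2 \<le> 1 - exp (- u)"
proof -
  have "u * (1 + u) \<le> u * 2" using assms by (intro mult_left_mono) auto
  then have "u / 2 \<le> 1 - 1 / (1 + u)" using assms by (simp add: field_simps)
  then show ?thesis using exp_minus_le_inverse[of u] assms by simp
qed

lemma one_le_1_minus_exp:
  fixes u :: real
  assumes "1 \<le> u"
  shows "1 \<le> 2 * (1 - exp (- u))"
proof -
  have "exp (- u) \<le> 1 / (1 + u)" using assms by (intro exp_minus_le_inverse) auto
  also have "\<dots> \<le> 1 / 2" using assms by (intro divide_left_mono) auto
  finally show ?thesis by simp
qed

text \<open>\<open>w s / s\<close> is the Levy density. Extending \<open>w\<close> by 0 to the
  negative axis turns convolutions on the half-line into integrals over the whole line.\<close>

locale bernstein_scaling =
  fixes w \<phi> :: "real \<Rightarrow> real" and k1 k2 \<beta>1 \<beta>2 :: real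
  assumes w_measurable [measurable]: "w \<in> borel_measurable borel"
    and w_nonneg: "\<And>s. 0 \<le> w s"
    and w_eq_0: "\<And>s. s \<le> 0 \<Longrightarrow> w s = 0"
    and w_antimono: "\<And>s t. 0 < s \<Longrightarrow> s \<le> t \<Longrightarrow> w t \<le> w s"
    and phi_eq: "\<And>l. l > 0 \<Longrightarrow> (\<integral>\<^sup>+s. ennreal ((1 - exp (- (l * s))) * (w s / s)) \<partial>lborel) = ennreal (\<phi> l)"
    and phi_pos: "\<And>l. l > 0 \<Longrightarrow> \<phi> l > 0"
    and exponents: "0 < \<beta>1" "0 < \<beta>2" "\<beta>2 < 1" "k1 > 0" "k2 > 0"
    and phi_ge: "\<And>l \<kappa>. l > 0 \<Longrightarrow> \<kappa> \<ge> 1 \<Longrightarrow> k1 * \<kappa> powr \<beta>1 * \<phi> l \<le> \<phi> (\<kappa> * l)"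
    and phi_le: "\<And>l \<kappa>. l > 0 \<Longrightarrow> \<kappa> \<ge> 1 \<Longrightarrow> \<phi> (\<kappa> * l) \<le> k2 * \<kappa> powr \<beta>2 * \<phi> l"
begin

section \<open>Size of \<open>w\<close> compared with \<phi>\<close>

lemma levy_integrand_nonneg: "l > 0 \<Longrightarrow> 0 \<le> (1 - exp (- (l * s))) * (w s / s)"
  using w_nonneg[of s] w_eq_0[of s] by (cases "s \<le> 0") auto

text \<open>With \<open>u = s / d \<le> 1\<close> the bound \<open>u / 2 \<le> 1 - exp (- u)\<close>
  compares \<open>w s\<close> with the integrand of \<open>\<phi> (1 / d)\<close>.\<close>

lemma nn_integral_w_le:
  assumes "d > 0"
  shows "(\<integral>\<^sup>+s\<in>{0<..d}. ennreal (w s) \<partial>lborel) \<le> ennreal (2 * d * \<phi> (1 / d))"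
proof -
  have "(\<integral>\<^sup>+s\<in>{0<..d}. ennreal (w s) \<partial>lborel)
      \<le> (\<integral>\<^sup>+s. ennreal (2 * d) * ennreal ((1 - exp (- (1 / d * s))) * (w s / s)) \<partial>lborel)"
  proof (intro nn_integral_mono)
    fix s :: real
    have "w s \<le> 2 * d * ((1 - exp (- (1 / d * s))) * (w s / s))" if s: "0 < s" "s \<le> d"
    proof -
      have "s / d / 2 \<le> 1 - exp (- (s / d))" using s by (intro half_le_1_minus_exp) auto
      then have "s \<le> 2 * d * (1 - exp (- (s / d)))" using s by (simp add: field_simps)
      then have "s * (w s / s) \<le> 2 * d * (1 - exp (- (s / d))) * (w s / s)"
        using s w_nonneg[of s] by (intro mult_right_mono) auto
      then show ?thesis using s by (simp add: mult_ac)
    qed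
    then show "ennreal (w s) * indicator {0<..d} s \<le> ennreal (2 * d) * ennreal ((1 - exp (- (1 / d * s))) * (w s / s))"
      using assms levy_integrand_nonneg[of "1/d" s]
      by (subst ennreal_mult[symmetric]) (auto split: split_indicator intro: ennreal_leI)
  qed
  also have "\<dots> = ennreal (2 * d) * ennreal (\<phi> (1 / d))"
    using assms phi_eq[of "1/d"] by (subst nn_integral_cmult) auto
  finally show ?thesis using assms phi_pos[of "1/d"] by (simp add: ennreal_mult)
qed

text \<open>As \<open>w\<close> decreases, \<open>d * w d\<close> is at most its integral over
  \<open>{0<..d}\<close>.\<close>

lemma w_le:
  assumes d: "d > 0"
  shows "w d \<le> 2 * \<phi> (1 / d)"
proof -
  have "ennreal (w d * d) = (\<integral>\<^sup>+s\<in>{0<..d}. ennreal (w d) \<partial>lborel)"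
    using d w_nonneg[of d] by (simp add: nn_integral_cmult_indicator ennreal_mult)
  also have "\<dots> \<le> (\<integral>\<^sup>+s\<in>{0<..d}. ennreal (w s) \<partial>lborel)"
    by (intro nn_integral_mono) (auto split: split_indicator intro!: ennreal_leI w_antimono)
  also have "\<dots> \<le> ennreal (2 * d * \<phi> (1 / d))" by (rule nn_integral_w_le[OF d])
  finally have "w d * d \<le> 2 * d * \<phi> (1 / d)"
    using d phi_pos[of "1/d"] by (subst (asm) ennreal_le_iff) auto
  then show ?thesis using d by (simp add: mult_ac)
qed

lemma nn_integral_levy_tail_le:
  assumes t: "t > 0"
  shows "(\<integral>\<^sup>+s\<in>{t<..}. ennreal (w s / s) \<partial>lborel) \<le> ennreal (2 * \<phi> (1 / t))"
proof -
  have "(\<integral>\<^sup>+s\<in>{t<..}. ennreal (w s / s) \<partial>lborel)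
      \<le> (\<integral>\<^sup>+s. ennreal 2 * ennreal ((1 - exp (- (1 / t * s))) * (w s / s)) \<partial>lborel)"
  proof (intro nn_integral_mono)
    fix s :: real
    have "w s / s \<le> 2 * ((1 - exp (- (1 / t * s))) * (w s / s))" if s: "t < s"
    proof -
      have "1 \<le> 2 * (1 - exp (- (s / t)))" using s t by (intro one_le_1_minus_exp) auto
      then have "1 * (w s / s) \<le> 2 * (1 - exp (- (s / t))) * (w s / s)"
        using s t w_nonneg[of s] by (intro mult_right_mono) auto
      then show ?thesis by (simp add: mult_ac)
    qed
    then show "ennreal (w s / s) * indicator {t<..} s \<le> ennreal 2 * ennreal ((1 - exp (- (1 / t * s))) * (w s / s))"
      using t levy_integrand_nonneg[of "1/t" s]
      by (subst ennreal_mult[symmetric]) (auto split: split_indicator intro: ennreal_leI)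
  qed
  also have "\<dots> = ennreal 2 * ennreal (\<phi> (1 / t))"
    using t phi_eq[of "1/t"] by (subst nn_integral_cmult) auto
  finally show ?thesis using t phi_pos[of "1/t"] by (simp add: ennreal_mult)
qed

text \<open>The Levy integral is cut at \<open>d * t\<close> and \<open>A * t\<close>. Below,
  \<open>1 - exp (- u) \<le> u\<close>; in the middle, \<open>w s / s\<close> is at most its value
  at \<open>d * t\<close> on an interval shorter than \<open>A * t\<close>; above, the tail estimate
  applies. Once the outer terms are small fractions of \<open>\<phi> (1 / t)\<close>, the middle one
  bounds \<open>w\<close> from below.\<close>

lemma phi_split:
  assumes t: "t > 0" and dA: "0 < d" "d \<le> 1" "1 \<le> A"
  shows "\<phi> (1 / t) \<le> 2 * d * \<phi> (1 / (d * t)) + w (d * t) * (A / d) + 2 * \<phi> (1 / (A * t))"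
proof -
  have "ennreal (\<phi> (1 / t)) = (\<integral>\<^sup>+s. ennreal ((1 - exp (- (1 / t * s))) * (w s / s)) \<partial>lborel)"
    using t phi_eq[of "1/t"] by simp
  also have "\<dots> \<le> (\<integral>\<^sup>+s. ennreal (1 / t) * (ennreal (w s) * indicator {0<..d * t} s)
      + (ennreal (w (d * t) / (d * t)) * indicator {d * t..A * t} s
      + ennreal (w s / s) * indicator {A * t<..} s) \<partial>lborel)"
  proof (intro nn_integral_mono)
    fix s :: real
    have le: "(1 - exp (- (1 / t * s))) * (w s / s) \<le> w s / s" if "s > 0"
      using that w_nonneg[of s] t mult_right_mono[of "1 - exp (- (1 / t * s))" 1 "w s / s"] by simp
    consider "s \<le> 0" | "0 < s" "s \<le> d * t" | "s > 0" "d * t < s" "s \<le> A * t" | "s > 0" "A * t < s" by linarith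
    then show "ennreal ((1 - exp (- (1 / t * s))) * (w s / s)) \<le> ennreal (1 / t) * (ennreal (w s) * indicator {0<..d * t} s)
      + (ennreal (w (d * t) / (d * t)) * indicator {d * t..A * t} s + ennreal (w s / s) * indicator {A * t<..} s)"
    proof cases
      case 1
      then show ?thesis by (simp add: w_eq_0)
    next
      case 2
      have "1 - exp (- (1 / t * s)) \<le> 1 / t * s" using exp_ge_add_one_self[of "- (1 / t * s)"] by simp
      then have "(1 - exp (- (1 / t * s))) * (w s / s) \<le> 1 / t * s * (w s / s)"
        using 2 w_nonneg[of s] by (intro mult_right_mono) auto
      also have "\<dots> = 1 / t * w s" using 2 by simp
      finally have "ennreal ((1 - exp (- (1 / t * s))) * (w s / s)) \<le> ennreal (1 / t) * (ennreal (w s) * indicator {0<..d * t} s)"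
        using 2 t w_nonneg[of s] by (simp add: ennreal_mult[symmetric] ennreal_leI)
      then show ?thesis by (rule add_increasing2[OF zero_le])
    next
      case 3
      have dt: "d * t > 0" using dA t by simp
      note le[OF 3(1)]
      also have "w s / s \<le> w (d * t) / (d * t)"
        using 3 dt w_antimono[of "d * t" s] w_nonneg[of s] by (intro frac_le) auto
      finally have "ennreal ((1 - exp (- (1 / t * s))) * (w s / s)) \<le> ennreal (w (d * t) / (d * t)) * indicator {d * t..A * t} s"
        using 3 by (simp add: ennreal_leI)
      then show ?thesis by (rule add_increasing[OF zero_le add_increasing2[OF zero_le]])
    next
      case 4
      have "ennreal ((1 - exp (- (1 / t * s))) * (w s / s)) \<le> ennreal (w s / s) * indicator {A * t<..} s"
        using le[OF 4(1)] 4 by (simp add: ennreal_leI)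
      then show ?thesis by (rule add_increasing[OF zero_le add_increasing[OF zero_le]])
    qed
  qed
  also have "\<dots> = ennreal (1 / t) * (\<integral>\<^sup>+s\<in>{0<..d * t}. ennreal (w s) \<partial>lborel)
      + (ennreal (w (d * t) / (d * t)) * emeasure lborel {d * t..A * t}
      + (\<integral>\<^sup>+s\<in>{A * t<..}. ennreal (w s / s) \<partial>lborel))"
    by (subst nn_integral_add, simp, simp, subst nn_integral_add) (auto simp: nn_integral_cmult nn_integral_cmult_indicator)
  also have "\<dots> \<le> ennreal (1 / t) * ennreal (2 * (d * t) * \<phi> (1 / (d * t)))
      + (ennreal (w (d * t) / (d * t)) * ennreal (A * t) + ennreal (2 * \<phi> (1 / (A * t))))"
  proof (intro add_mono mult_left_mono)
    have "d * t \<le> A * t" using dA t by simp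
    then show "emeasure lborel {d * t..A * t} \<le> ennreal (A * t)"
      using t dA by (simp add: ennreal_leI)
  qed (use t dA nn_integral_w_le[of "d*t"] nn_integral_levy_tail_le[of "A*t"] in auto)
  also have "\<dots> = ennreal (1 / t * (2 * (d * t) * \<phi> (1 / (d * t))) + (w (d * t) / (d * t) * (A * t) + 2 * \<phi> (1 / (A * t))))"
    using t dA phi_pos[of "1/(d*t)"] phi_pos[of "1/(A*t)"] w_nonneg[of "d*t"]
    by (simp add: ennreal_mult[symmetric] ennreal_plus[symmetric] del: ennreal_plus)
  finally have "\<phi> (1 / t) \<le> 1 / t * (2 * (d * t) * \<phi> (1 / (d * t))) + (w (d * t) / (d * t) * (A * t) + 2 * \<phi> (1 / (A * t)))"
    using t dA phi_pos[of "1/(d*t)"] phi_pos[of "1/(A*t)"] w_nonneg[of "d*t"]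
    by (subst (asm) ennreal_le_iff) auto
  also have "\<dots> = 2 * d * \<phi> (1 / (d * t)) + w (d * t) * (A / d) + 2 * \<phi> (1 / (A * t))"
    using t dA by (simp add: field_simps)
  finally show ?thesis .
qed

lemma phi_div_le:
  assumes "t > 0" "0 < d" "d \<le> 1"
  shows "\<phi> (1 / (d * t)) \<le> k2 * d powr (- \<beta>2) * \<phi> (1 / t)"
  using phi_le[of "1/t" "1/d"] assms by (simp add: powr_divide powr_minus_divide)

lemma w_ge: obtains c where "c > 0" "\<And>t. t > 0 \<Longrightarrow> c * \<phi> (1 / t) \<le> w t"
proof -
  \<comment> \<open>The choice of \<open>d\<close> uses \<beta>2 < 1 and makes the first term of
    \<open>phi_split\<close> at most \<open>\<phi> (1 / t) / 4\<close>. The choice of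
    \<open>a\<close>, with \<open>A = 1 / a\<close>, uses the lower scaling and does the same for
    the last term. Half of \<open>\<phi> (1 / t)\<close> is left for
    \<open>w (d * t)\<close>.\<close>
  obtain d where d: "0 < d" "d \<le> 1" "d powr (1 - \<beta>2) \<le> 1 / (8 * k2)"
    using ex_powr_le[of "1 - \<beta>2" "1 / (8 * k2)"] exponents by auto
  obtain a where a: "0 < a" "a \<le> 1" "a powr \<beta>1 \<le> k1 / 8"
    using ex_powr_le[of "\<beta>1" "k1 / 8"] exponents by auto
  define c0 where "c0 = a * d / 2"
  have c0: "c0 > 0" using a d by (simp add: c0_def)
  have 1: "c0 * \<phi> (1 / t) \<le> w (d * t)" if t: "t > 0" for t
  proof -
    have p: "\<phi> (1/t) > 0" using t by (simp add: phi_pos)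
    have "2 * d * \<phi> (1 / (d * t)) \<le> 2 * d * (k2 * d powr (- \<beta>2) * \<phi> (1 / t))"
      using phi_div_le[of t d] t d by (intro mult_left_mono) auto
    also have "\<dots> = 2 * k2 * \<phi> (1 / t) * d powr (1 - \<beta>2)" using d by (simp add: powr_diff powr_minus_divide)
    also have "\<dots> \<le> 2 * k2 * \<phi> (1 / t) * (1 / (8 * k2))" using p exponents d by (intro mult_left_mono) auto
    also have "\<dots> = \<phi> (1 / t) / 4" using exponents by simp
    finally have i: "2 * d * \<phi> (1 / (d * t)) \<le> \<phi> (1 / t) / 4" .
    have q: "\<phi> (1 / (1 / a * t)) > 0" using t a by (simp add: phi_pos)
    have "k1 * (1 / a) powr \<beta>1 * \<phi> (1 / (1 / a * t)) \<le> \<phi> (1 / a * (1 / (1 / a * t)))"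
      using t a by (intro phi_ge) auto
    also have "1 / a * (1 / (1 / a * t)) = 1 / t" using a by simp
    also have "(1 / a) powr \<beta>1 = 1 / a powr \<beta>1" using a by (simp add: powr_divide)
    finally have "k1 * \<phi> (1 / (1 / a * t)) \<le> \<phi> (1 / t) * a powr \<beta>1"
      using a by (simp add: field_simps)
    also have "\<dots> \<le> \<phi> (1 / t) * (k1 / 8)" using a p by (intro mult_left_mono) auto
    finally have "k1 * \<phi> (1 / (1 / a * t)) \<le> k1 * (\<phi> (1 / t) / 8)" by (simp add: mult.commute)
    then have ii: "2 * \<phi> (1 / (1 / a * t)) \<le> \<phi> (1 / t) / 4"
      using exponents by (simp only: mult_le_cancel_left_pos)
    have "\<phi> (1 / t) \<le> 2 * d * \<phi> (1 / (d * t)) + w (d * t) * (1 / a / d) + 2 * \<phi> (1 / (1 / a * t))"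
      using t d a by (intro phi_split) auto
    then have "\<phi> (1 / t) / 2 \<le> w (d * t) * (1 / a / d)" using i ii by simp
    then show ?thesis using a d by (simp add: c0_def field_simps)
  qed
  show ?thesis
  proof (rule that[of "c0 * (d powr \<beta>2 / k2)"])
    show "0 < c0 * (d powr \<beta>2 / k2)" using c0 d exponents by simp
    fix t :: real assume t: "t > 0"
    \<comment> \<open>The bound obtained so far concerns \<open>w (d * t)\<close>. It is applied at
      \<open>t / d\<close>, and the upper scaling pays for replacing
      \<open>\<phi> (1 / (t / d))\<close> by \<open>\<phi> (1 / t)\<close>.\<close>
    have "\<phi> (1 / t) \<le> k2 * d powr (- \<beta>2) * \<phi> (1 / (t / d))"
      using phi_div_le[of "t/d" d] t d by simp
    then have "d powr \<beta>2 / k2 * \<phi> (1 / t) \<le> d powr \<beta>2 / k2 * (k2 * d powr (- \<beta>2) * \<phi> (1 / (t / d)))"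
      using exponents by (intro mult_left_mono) auto
    also have "\<dots> = \<phi> (1 / (t / d))" using d exponents by (simp add: powr_minus_divide)
    finally have "c0 * (d powr \<beta>2 / k2) * \<phi> (1 / t) \<le> c0 * \<phi> (1 / (t / d))"
      unfolding mult.assoc[of c0] using c0 by (intro mult_left_mono) auto
    also have "\<dots> \<le> w t" using 1[of "t/d"] t d by simp
    finally show "c0 * (d powr \<beta>2 / k2) * \<phi> (1 / t) \<le> w t" .
  qed
qed

lemma phi_DERIV:
  assumes "l > 0"
  obtains D where "D \<ge> 0" "(\<phi> has_real_derivative D) (at l)"
    "(\<integral>\<^sup>+s. ennreal (w s * exp (- (l * s))) \<partial>lborel) = ennreal D"
proof -
  \<comment> \<open>At \<open>s = 0\<close> both sides vanish, since \<open>w 0 = 0\<close>.\<close>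
  have "s * (w s / s) = w s" for s using w_eq_0[of s] by (cases "s = 0") auto
  then show ?thesis
    using DERIV_nn_integral_1_minus_exp[of "\<lambda>s. w s / s" \<phi> l] assms w_nonneg w_eq_0 phi_eq phi_pos that
    by (fastforce simp: less_imp_le divide_simps)
qed

lemma phi_continuous: "continuous_on {0<..} (\<lambda>t. \<phi> (1 / t))"
proof (rule continuous_on_compose2[where g = \<phi> and t = "{0<..}"])
  show "continuous_on {0<..} \<phi>"
    by (rule continuous_at_imp_continuous_on) (metis DERIV_isCont phi_DERIV greaterThan_iff)
qed (auto intro!: continuous_intros)

text \<open>The analytic properties of the density of \<open>S_r\<close>, extended by 0 to the
  negative axis. Continuity serves to pass from almost all to all times, boundedness to make the
  supremum in the absorption argument finite.\<close>

definition is_density :: "real \<Rightarrow> (real \<Rightarrow> real) \<Rightarrow> bool" where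
  "is_density r p \<longleftrightarrow> r > 0 \<and> p \<in> borel_measurable borel \<and> (\<forall>s. 0 \<le> p s) \<and> (\<forall>s\<le>0. p s = 0) \<and>
     continuous_on {0<..} p \<and> (\<exists>B. \<forall>s. p s \<le> B) \<and> (\<integral>\<^sup>+s. ennreal (p s) \<partial>lborel) = 1 \<and>
     (\<forall>l>0. (\<integral>\<^sup>+s. ennreal (p s * exp (- (l * s))) \<partial>lborel) = ennreal (exp (- (r * \<phi> l))))"

context
  fixes r p assumes dens: "is_density r p"
begin

lemma r_pos: "r > 0"
  and p_measurable: "p \<in> borel_measurable borel"
  and p_nonneg: "0 \<le> p s" and p_eq_0: "s \<le> 0 \<Longrightarrow> p s = 0"
  and p_continuous: "continuous_on {0<..} p"
  and p_bounded: "\<exists>B. \<forall>s. p s \<le> B"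
  and p_mass: "(\<integral>\<^sup>+s. ennreal (p s) \<partial>lborel) = 1"
  and p_laplace: "l > 0 \<Longrightarrow> (\<integral>\<^sup>+s. ennreal (p s * exp (- (l * s))) \<partial>lborel) = ennreal (exp (- (r * \<phi> l)))"
  using dens by (auto simp: is_density_def)

text \<open>Brings the transform into the form with \<open>1 - exp\<close> that
  \<open>DERIV_nn_integral_1_minus_exp\<close> differentiates. The subtraction in
  \<open>ennreal\<close> is legitimate because the total mass is 1.\<close>

lemma p_laplace':
  assumes "l > 0"
  shows "(\<integral>\<^sup>+s. ennreal ((1 - exp (- (l * s))) * p s) \<partial>lborel) = ennreal (1 - exp (- (r * \<phi> l)))"
proof -
  note [measurable] = p_measurable
  have "(\<integral>\<^sup>+s. ennreal ((1 - exp (- (l * s))) * p s) \<partial>lborel)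
      = (\<integral>\<^sup>+s. ennreal (p s) - ennreal (p s * exp (- (l * s))) \<partial>lborel)"
    using p_nonneg by (intro nn_integral_cong) (simp add: ennreal_minus algebra_simps)
  also have "\<dots> = (\<integral>\<^sup>+s. ennreal (p s) \<partial>lborel) - (\<integral>\<^sup>+s. ennreal (p s * exp (- (l * s))) \<partial>lborel)"
  proof (intro nn_integral_diff)
    have "p s * exp (- (l * s)) \<le> p s" for s
      using p_nonneg[of s] p_eq_0[of s] assms by (cases "s \<le> 0") (auto intro!: mult_left_le)
    then show "AE s in lborel. ennreal (p s * exp (- (l * s))) \<le> ennreal (p s)"
      by (intro AE_I2 ennreal_leI)
  qed (use assms in \<open>auto simp: p_laplace\<close>)
  also have "\<dots> = ennreal (1 - exp (- (r * \<phi> l)))"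
    using assms by (simp add: p_mass p_laplace ennreal_minus flip: ennreal_1)
  finally show ?thesis .
qed

text \<open>On the Laplace side this is \<open>- (exp (- r \<phi>))' = r \<phi>' exp (- r \<phi>)\<close>, where \<open>\<phi>'\<close> is the transform of \<open>w\<close>.\<close>

lemma density_identity:
  "AE t in lborel. ennreal (t * p t) = ennreal r * (\<integral>\<^sup>+s. ennreal (w s * p (t - s)) \<partial>lborel)"
proof -
  note [measurable] = p_measurable
  show ?thesis
  proof (rule laplace_transform_unique)
    have lhs: "(\<integral>\<^sup>+t. ennreal (t * p t) * ennreal (exp (- (l * t))) \<partial>lborel) = ennreal (r * D * exp (- (r * \<phi> l)))"
      if l: "l > 0" and D: "(\<phi> has_real_derivative D) (at l)" for l D
    proof -
      have "\<exists>D'\<ge>0. ((\<lambda>l. 1 - exp (- (r * \<phi> l))) has_real_derivative D') (at l) \<and>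
         (\<integral>\<^sup>+s. ennreal (s * p s * exp (- (l * s))) \<partial>lborel) = ennreal D'"
        using l p_nonneg p_eq_0 r_pos phi_pos
        by (intro DERIV_nn_integral_1_minus_exp) (auto simp: p_laplace' less_imp_le)
      then obtain D' where D': "((\<lambda>l. 1 - exp (- (r * \<phi> l))) has_real_derivative D') (at l)"
         "(\<integral>\<^sup>+s. ennreal (s * p s * exp (- (l * s))) \<partial>lborel) = ennreal D'" by blast
      have "((\<lambda>l. 1 - exp (- (r * \<phi> l))) has_real_derivative r * D * exp (- (r * \<phi> l))) (at l)"
        using D by (auto intro!: derivative_eq_intros)
      then have "D' = r * D * exp (- (r * \<phi> l))" using D'(1) DERIV_unique by blast
      then show ?thesis using D'(2) by (simp add: ennreal_mult''[symmetric])
    qed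
    \<comment> \<open>The transform of a convolution is the product of the transforms, by Tonelli,
      translation in \<open>t\<close>, and the factorization of \<open>exp (- (l * t))\<close> into
      factors at \<open>s\<close> and \<open>t - s\<close>.\<close>
    have rhs: "(\<integral>\<^sup>+t. ennreal r * (\<integral>\<^sup>+s. ennreal (w s * p (t - s)) \<partial>lborel) * ennreal (exp (- (l * t))) \<partial>lborel)
        = ennreal (r * D * exp (- (r * \<phi> l)))"
      if l: "l > 0" and D: "D \<ge> 0" "(\<integral>\<^sup>+s. ennreal (w s * exp (- (l * s))) \<partial>lborel) = ennreal D" for l D
    proof -
      have "(\<integral>\<^sup>+t. ennreal r * (\<integral>\<^sup>+s. ennreal (w s * p (t - s)) \<partial>lborel) * ennreal (exp (- (l * t))) \<partial>lborel)
         = (\<integral>\<^sup>+t. (\<integral>\<^sup>+s. ennreal r * (ennreal (w s * exp (- (l * s))) * ennreal (p (t - s) * exp (- (l * (t - s))))) \<partial>lborel) \<partial>lborel)"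
      proof (intro nn_integral_cong)
        fix t :: real
        have "ennreal r * (\<integral>\<^sup>+s. ennreal (w s * p (t - s)) \<partial>lborel) * ennreal (exp (- (l * t)))
           = (\<integral>\<^sup>+s. ennreal r * ennreal (w s * p (t - s)) * ennreal (exp (- (l * t))) \<partial>lborel)"
          by (simp add: nn_integral_cmult nn_integral_multc)
        also have "\<dots> = (\<integral>\<^sup>+s. ennreal r * (ennreal (w s * exp (- (l * s))) * ennreal (p (t - s) * exp (- (l * (t - s))))) \<partial>lborel)"
        proof (intro nn_integral_cong)
          fix s :: real
          have "exp (- (l * t)) = exp (- (l * s)) * exp (- (l * (t - s)))"
            by (simp add: exp_add[symmetric] algebra_simps)
          then have "r * (w s * p (t - s)) * exp (- (l * t)) = r * ((w s * exp (- (l * s))) * (p (t - s) * exp (- (l * (t - s)))))"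
            by simp
          then show "ennreal r * ennreal (w s * p (t - s)) * ennreal (exp (- (l * t)))
            = ennreal r * (ennreal (w s * exp (- (l * s))) * ennreal (p (t - s) * exp (- (l * (t - s)))))"
            using w_nonneg[of s] p_nonneg[of "t-s"] r_pos by (simp add: ennreal_mult[symmetric])
        qed
        finally show "ennreal r * (\<integral>\<^sup>+s. ennreal (w s * p (t - s)) \<partial>lborel) * ennreal (exp (- (l * t)))
           = (\<integral>\<^sup>+s. ennreal r * (ennreal (w s * exp (- (l * s))) * ennreal (p (t - s) * exp (- (l * (t - s))))) \<partial>lborel)" .
      qed
      also have "\<dots> = (\<integral>\<^sup>+s. (\<integral>\<^sup>+t. ennreal r * (ennreal (w s * exp (- (l * s))) * ennreal (p (t - s) * exp (- (l * (t - s))))) \<partial>lborel) \<partial>lborel)"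
        by (intro lborel_pair.Fubini') measurable
      also have "\<dots> = (\<integral>\<^sup>+s. ennreal r * (ennreal (w s * exp (- (l * s))) * ennreal (exp (- (r * \<phi> l)))) \<partial>lborel)"
      proof (intro nn_integral_cong)
        fix s :: real
        have "(\<integral>\<^sup>+t. ennreal r * (ennreal (w s * exp (- (l * s))) * ennreal (p (t - s) * exp (- (l * (t - s))))) \<partial>lborel)
          = ennreal r * (ennreal (w s * exp (- (l * s))) * (\<integral>\<^sup>+t. ennreal (p (t - s) * exp (- (l * (t - s)))) \<partial>lborel))"
          by (simp add: nn_integral_cmult)
        also have "(\<integral>\<^sup>+t. ennreal (p (t - s) * exp (- (l * (t - s)))) \<partial>lborel) = (\<integral>\<^sup>+u. ennreal (p u * exp (- (l * u))) \<partial>lborel)"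
          by (subst nn_integral_real_affine[where c = 1 and t = s]) auto
        finally show "(\<integral>\<^sup>+t. ennreal r * (ennreal (w s * exp (- (l * s))) * ennreal (p (t - s) * exp (- (l * (t - s))))) \<partial>lborel)
          = ennreal r * (ennreal (w s * exp (- (l * s))) * ennreal (exp (- (r * \<phi> l))))" using l by (simp add: p_laplace)
      qed
      also have "\<dots> = ennreal r * (ennreal D * ennreal (exp (- (r * \<phi> l))))"
        by (subst nn_integral_cmult, simp, subst nn_integral_multc) (auto simp: D)
      also have "\<dots> = ennreal (r * D * exp (- (r * \<phi> l)))"
        using D r_pos by (simp add: ennreal_mult[symmetric] mult.assoc)
      finally show ?thesis .
    qed
    fix l :: real assume l: "l > 0"
    obtain D where D: "D \<ge> 0" "(\<phi> has_real_derivative D) (at l)"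
      "(\<integral>\<^sup>+s. ennreal (w s * exp (- (l * s))) \<partial>lborel) = ennreal D" using phi_DERIV[OF l] by blast
    show "(\<integral>\<^sup>+t. ennreal (t * p t) * ennreal (exp (- (l * t))) \<partial>lborel)
      = (\<integral>\<^sup>+t. ennreal r * (\<integral>\<^sup>+s. ennreal (w s * p (t - s)) \<partial>lborel) * ennreal (exp (- (l * t))) \<partial>lborel)"
      using lhs[OF l D(2)] rhs[OF l D(1,3)] by simp
    show "(\<integral>\<^sup>+t. ennreal (t * p t) * ennreal (exp (- (l * t))) \<partial>lborel) < \<infinity>"
      using lhs[OF l D(2)] by simp
  next
    fix t :: real assume t: "t \<le> 0"
    show "ennreal (t * p t) = 0" using p_eq_0[OF t] by simp
    have z: "w s * p (t - s) = 0" for s using t w_eq_0[of s] p_eq_0[of "t - s"] by (cases "s \<le> 0") auto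
    show "ennreal r * (\<integral>\<^sup>+s. ennreal (w s * p (t - s)) \<partial>lborel) = 0" by (simp only: z) simp
  qed measurable
qed

text \<open>Exponential Chebyshev inequality: \<open>1 \<le> exp (1 - s / t)\<close> for
  \<open>s \<le> t\<close>, and then the transform at \<open>1 / t\<close>.\<close>

lemma nn_integral_p_le:
  assumes t: "t > 0"
  shows "(\<integral>\<^sup>+s\<in>{..t}. ennreal (p s) \<partial>lborel) \<le> ennreal (exp (1 - r * \<phi> (1 / t)))"
proof -
  note [measurable] = p_measurable
  have "(\<integral>\<^sup>+s\<in>{..t}. ennreal (p s) \<partial>lborel) \<le> (\<integral>\<^sup>+s. ennreal (exp 1) * ennreal (p s * exp (- (1 / t * s))) \<partial>lborel)"
  proof (intro nn_integral_mono)
    fix s :: real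
    have "p s \<le> exp 1 * (p s * exp (- (1 / t * s)))" if "s \<le> t"
    proof -
      have "p s * 1 \<le> p s * exp (1 - s / t)"
        using that t p_nonneg by (intro mult_left_mono) auto
      then show ?thesis by (simp add: exp_diff exp_minus field_simps)
    qed
    then show "ennreal (p s) * indicator {..t} s \<le> ennreal (exp 1) * ennreal (p s * exp (- (1 / t * s)))"
      using p_nonneg[of s] by (subst ennreal_mult[symmetric]) (auto split: split_indicator intro: ennreal_leI)
  qed
  also have "\<dots> = ennreal (exp 1) * ennreal (exp (- (r * \<phi> (1 / t))))"
    using t p_laplace[of "1/t"] by (subst nn_integral_cmult) auto
  also have "\<dots> = ennreal (exp (1 - r * \<phi> (1 / t)))"
    by (subst ennreal_mult[symmetric]) (auto simp: exp_add[symmetric])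
  finally show ?thesis .
qed

text \<open>A Markov bound for the complement: \<open>1 \<le> 2 * (1 - exp (- s / t))\<close> for
  \<open>s > t\<close>, so the mass above \<open>t\<close> is at most
  \<open>2 * (1 - exp (- r * \<phi> (1 / t)))\<close>, hence at most
  \<open>2 * (1 / 4)\<close>.\<close>

lemma nn_integral_p_ge:
  assumes t: "t > 0" and small: "r * \<phi> (1 / t) \<le> 1 / 4"
  shows "ennreal (1 / 2) \<le> (\<integral>\<^sup>+s\<in>{..t}. ennreal (p s) \<partial>lborel)"
proof -
  note [measurable] = p_measurable
  have "(\<integral>\<^sup>+s\<in>{t<..}. ennreal (p s) \<partial>lborel) \<le> (\<integral>\<^sup>+s. ennreal 2 * ennreal ((1 - exp (- (1 / t * s))) * p s) \<partial>lborel)"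
  proof (intro nn_integral_mono)
    fix s :: real
    have nn: "0 \<le> (1 - exp (- (1 / t * s))) * p s"
      using p_nonneg[of s] p_eq_0[of s] t by (cases "s \<le> 0") auto
    have "p s \<le> 2 * ((1 - exp (- (1 / t * s))) * p s)" if "t < s"
    proof -
      have "1 \<le> 2 * (1 - exp (- (s / t)))" using that t by (intro one_le_1_minus_exp) auto
      then have "1 * p s \<le> 2 * (1 - exp (- (s / t))) * p s"
        using p_nonneg[of s] by (intro mult_right_mono) auto
      then show ?thesis by (simp add: mult_ac)
    qed
    then show "ennreal (p s) * indicator {t<..} s \<le> ennreal 2 * ennreal ((1 - exp (- (1 / t * s))) * p s)"
      using nn by (subst ennreal_mult[symmetric]) (auto split: split_indicator intro: ennreal_leI)
  qed
  also have "\<dots> = ennreal 2 * ennreal (1 - exp (- (r * \<phi> (1 / t))))"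
    using t p_laplace'[of "1/t"] by (subst nn_integral_cmult) auto
  also have "\<dots> \<le> ennreal 2 * ennreal (1 / 4)"
    using exp_ge_add_one_self[of "- (r * \<phi> (1 / t))"] small by (intro mult_left_mono ennreal_leI) auto
  also have "\<dots> = ennreal (1 / 2)" by (subst ennreal_mult[symmetric]) auto
  finally have tail: "(\<integral>\<^sup>+s\<in>{t<..}. ennreal (p s) \<partial>lborel) \<le> ennreal (1 / 2)" .
  have "ennreal (1 / 2) + ennreal (1 / 2) = 1" by (subst ennreal_plus[symmetric]) auto
  also have "1 = (\<integral>\<^sup>+s. ennreal (p s) * indicator {..t} s + ennreal (p s) * indicator {t<..} s \<partial>lborel)"
    unfolding p_mass[symmetric] by (intro nn_integral_cong) (auto split: split_indicator)
  also have "\<dots> = (\<integral>\<^sup>+s\<in>{..t}. ennreal (p s) \<partial>lborel) + (\<integral>\<^sup>+s\<in>{t<..}. ennreal (p s) \<partial>lborel)"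
    by (intro nn_integral_add) auto
  also have "\<dots> \<le> (\<integral>\<^sup>+s\<in>{..t}. ennreal (p s) \<partial>lborel) + ennreal (1 / 2)"
    using tail by (intro add_left_mono)
  finally show ?thesis by (simp add: ennreal_add_left_cancel_le add.commute)
qed

section \<open>One-step estimates from the convolution identity\<close>

lemma nn_integral_p_reflect:
  "(\<integral>\<^sup>+s\<in>{0<..}. ennreal (p (t - s)) \<partial>lborel) = (\<integral>\<^sup>+s\<in>{..<t}. ennreal (p s) \<partial>lborel)"
proof -
  note [measurable] = p_measurable
  have "(\<integral>\<^sup>+s\<in>{..<t}. ennreal (p s) \<partial>lborel) = ennreal \<bar>-1\<bar> * (\<integral>\<^sup>+s. ennreal (p (t + (-1) * s)) * indicator {..<t} (t + (-1) * s) \<partial>lborel)"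
    by (intro nn_integral_real_affine) auto
  also have "\<dots> = (\<integral>\<^sup>+s\<in>{0<..}. ennreal (p (t - s)) \<partial>lborel)"
    by (simp, intro nn_integral_cong) (auto split: split_indicator)
  finally show ?thesis by simp
qed

text \<open>The convolution is cut at \<open>s = d\<close>. For larger \<open>s\<close> the factor
  \<open>w s\<close> is at most \<open>w d\<close> and the remaining mass of \<open>p\<close> is
  exponentially small; for smaller \<open>s\<close> the factor \<open>p (t - s)\<close> is at most
  \<open>K\<close> and \<open>w\<close> is integrated. The identity is a hypothesis at the single
  time \<open>t\<close> because it is known only for almost every \<open>t\<close>.\<close>

lemma upper_step:
  assumes id: "ennreal (t * p t) = ennreal r * (\<integral>\<^sup>+s. ennreal (w s * p (t - s)) \<partial>lborel)"
    and t: "t > 0" and d: "0 < d"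
    and K: "\<And>s. s \<in> {t - d..<t} \<Longrightarrow> p s \<le> K" "K \<ge> 0"
  shows "t * p t \<le> r * (2 * \<phi> (1 / d) * exp (1 - r * \<phi> (1 / t)) + K * (2 * d * \<phi> (1 / d)))"
proof -
  note [measurable] = p_measurable
  have pd: "\<phi> (1 / d) > 0" using d phi_pos by simp
  have "(\<integral>\<^sup>+s. ennreal (w s * p (t - s)) \<partial>lborel)
     \<le> (\<integral>\<^sup>+s. ennreal (w d) * (ennreal (p (t - s)) * indicator {0<..} s) + ennreal K * (ennreal (w s) * indicator {0<..d} s) \<partial>lborel)"
  proof (intro nn_integral_mono)
    fix s :: real
    consider "s \<le> 0" | "0 < s" "s \<le> d" | "d < s" by linarith
    then show "ennreal (w s * p (t - s)) \<le> ennreal (w d) * (ennreal (p (t - s)) * indicator {0<..} s) + ennreal K * (ennreal (w s) * indicator {0<..d} s)"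
    proof cases
      case 2
      have "w s * p (t - s) \<le> K * w s"
        using 2 w_nonneg[of s] mult_left_mono[OF K(1)[of "t - s"], of "w s"] by (simp add: mult.commute)
      then have "ennreal (w s * p (t - s)) \<le> ennreal K * (ennreal (w s) * indicator {0<..d} s)"
        using 2 K w_nonneg by (simp add: ennreal_mult[symmetric] ennreal_leI)
      then show ?thesis by (rule add_increasing[OF zero_le])
    next
      case 3
      have "w s * p (t - s) \<le> w d * p (t - s)"
        using 3 d p_nonneg by (intro mult_right_mono w_antimono) auto
      then have "ennreal (w s * p (t - s)) \<le> ennreal (w d) * (ennreal (p (t - s)) * indicator {0<..} s)"
        using 3 d p_nonneg w_nonneg by (simp add: ennreal_mult[symmetric] ennreal_leI)
      then show ?thesis by (rule add_increasing2[OF zero_le])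
    qed (simp add: w_eq_0)
  qed
  also have "\<dots> = ennreal (w d) * (\<integral>\<^sup>+s\<in>{..<t}. ennreal (p s) \<partial>lborel) + ennreal K * (\<integral>\<^sup>+s\<in>{0<..d}. ennreal (w s) \<partial>lborel)"
    by (subst nn_integral_add) (auto simp: nn_integral_cmult nn_integral_p_reflect)
  also have "\<dots> \<le> ennreal (2 * \<phi> (1 / d)) * ennreal (exp (1 - r * \<phi> (1 / t))) + ennreal K * ennreal (2 * d * \<phi> (1 / d))"
  proof (intro add_mono mult_mono mult_left_mono ennreal_leI w_le d nn_integral_w_le)
    have "(\<integral>\<^sup>+s\<in>{..<t}. ennreal (p s) \<partial>lborel) \<le> (\<integral>\<^sup>+s\<in>{..t}. ennreal (p s) \<partial>lborel)"
      by (intro nn_integral_mono) (auto split: split_indicator)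
    then show "(\<integral>\<^sup>+s\<in>{..<t}. ennreal (p s) \<partial>lborel) \<le> ennreal (exp (1 - r * \<phi> (1 / t)))"
      using nn_integral_p_le[OF t] by order
  qed auto
  also have "\<dots> = ennreal (2 * \<phi> (1 / d) * exp (1 - r * \<phi> (1 / t)) + K * (2 * d * \<phi> (1 / d)))"
    using K pd d by (simp add: ennreal_mult[symmetric] ennreal_plus[symmetric] del: ennreal_plus)
  finally have "ennreal (t * p t) \<le> ennreal r * ennreal (2 * \<phi> (1 / d) * exp (1 - r * \<phi> (1 / t)) + K * (2 * d * \<phi> (1 / d)))"
    unfolding id by (rule mult_left_mono) simp
  also have "\<dots> = ennreal (r * (2 * \<phi> (1 / d) * exp (1 - r * \<phi> (1 / t)) + K * (2 * d * \<phi> (1 / d))))"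
    using r_pos pd K d by (subst ennreal_mult) auto
  finally show ?thesis
    using r_pos pd K d by (subst (asm) ennreal_le_iff) auto
qed

text \<open>On \<open>s \<le> t\<close> one has \<open>w s \<ge> w t\<close>, and \<open>p\<close>
  has at least half of its mass below \<open>t\<close>.\<close>

lemma lower_step:
  assumes id: "ennreal (t * p t) = ennreal r * (\<integral>\<^sup>+s. ennreal (w s * p (t - s)) \<partial>lborel)"
    and t: "t > 0" and small: "r * \<phi> (1 / t) \<le> 1 / 4"
  shows "r * w t / 2 \<le> t * p t"
proof -
  note [measurable] = p_measurable
  have "ennreal (1 / 2) \<le> (\<integral>\<^sup>+s\<in>{..t}. ennreal (p s) \<partial>lborel)" by (rule nn_integral_p_ge[OF t small])
  also have "\<dots> = (\<integral>\<^sup>+s\<in>{..<t}. ennreal (p s) \<partial>lborel)"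
    by (intro nn_integral_cong_AE eventually_mono[OF AE_lborel_singleton[of t]]) (auto split: split_indicator)
  finally have "ennreal (w t) * ennreal (1 / 2) \<le> ennreal (w t) * (\<integral>\<^sup>+s\<in>{0<..}. ennreal (p (t - s)) \<partial>lborel)"
    unfolding nn_integral_p_reflect by (rule mult_left_mono) simp
  also have "\<dots> = (\<integral>\<^sup>+s. ennreal (w t) * (ennreal (p (t - s)) * indicator {0<..} s) \<partial>lborel)"
    by (intro nn_integral_cmult[symmetric]) simp
  also have "\<dots> \<le> (\<integral>\<^sup>+s. ennreal (w s * p (t - s)) \<partial>lborel)"
  proof (intro nn_integral_mono)
    fix s :: real
    have "w t * p (t - s) \<le> w s * p (t - s)" if "s > 0"
      using that p_nonneg[of "t-s"] p_eq_0[of "t-s"] w_antimono[of s t]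
      by (cases "s \<le> t") (auto intro!: mult_right_mono)
    then show "ennreal (w t) * (ennreal (p (t - s)) * indicator {0<..} s) \<le> ennreal (w s * p (t - s))"
      using p_nonneg w_nonneg by (auto simp: ennreal_mult[symmetric] split: split_indicator intro!: ennreal_leI)
  qed
  finally have "ennreal r * (ennreal (w t) * ennreal (1 / 2)) \<le> ennreal (t * p t)"
    unfolding id by (rule mult_left_mono) simp
  also have "ennreal r * (ennreal (w t) * ennreal (1 / 2)) = ennreal (r * w t / 2)"
    using r_pos w_nonneg[of t] by (simp add: ennreal_mult[symmetric] del: ennreal_half)
  finally show ?thesis using t p_nonneg[of t] by (subst (asm) ennreal_le_iff) auto
qed

end

section \<open>Uniform pointwise bounds for the densities\<close>

lemma upper_improve:
  obtains C where "C > 0"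
    "\<And>r p t H. is_density r p \<Longrightarrow> t > 0 \<Longrightarrow> H \<ge> 0 \<Longrightarrow> (\<And>s. 0 < s \<Longrightarrow> s < t \<Longrightarrow> s * p s \<le> H) \<Longrightarrow>
       ennreal (t * p t) = ennreal r * (\<integral>\<^sup>+s. ennreal (w s * p (t - s)) \<partial>lborel) \<Longrightarrow>
       t * p t \<le> (C + H / 2) * (r * \<phi> (1 / t) * max 1 (r * \<phi> (1 / t)) powr (- 5))"
proof -
  \<comment> \<open>Cutting at \<open>\<delta> = \<eta> t\<close> with \<open>\<eta> = a max(1,x)\<^sup>-\<^sup>b\<close> makes the factor \<open>x \<eta>\<^sup>1\<^sup>-\<^sup>\<beta>\<^sup>2\<close> of \<open>H\<close> equal to a small multiple of
    \<open>x max(1,x)\<^sup>-\<^sup>5\<close>; the other term keeps the factor \<open>exp (- x)\<close>.\<close>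
  define b where "b = 5 / (1 - \<beta>2)"
  have b: "b > 0" "b * (1 - \<beta>2) = 5"
    using exponents by (auto simp only: b_def times_divide_eq_left nonzero_mult_div_cancel_right) auto
  obtain a0 where a0: "0 < a0" "a0 \<le> 1" "a0 powr (1 - \<beta>2) \<le> 1 / (8 * k2)"
    using ex_powr_le[of "1 - \<beta>2" "1 / (8 * k2)"] exponents by auto
  \<comment> \<open>Halving \<open>a0\<close> gives \<open>\<eta> \<le> 1 / 2\<close>. Then
    \<open>s \<ge> t / 2\<close> throughout \<open>{t - \<eta> * t..<t}\<close>, so a bound
    \<open>H\<close> for \<open>s * p s\<close> becomes \<open>2 * H / t\<close> for
    \<open>p s\<close>. The threshold \<open>1 / (8 * k2)\<close> turns the resulting
    \<open>4 * H * k2\<close> into \<open>H / 2\<close>.\<close>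
  define a where "a = a0 / 2"
  have a: "0 < a" "a \<le> 1 / 2" using a0 by (auto simp: a_def)
  have "a powr (1 - \<beta>2) \<le> a0 powr (1 - \<beta>2)" using a0 exponents by (intro powr_mono2) (auto simp: a_def)
  with a0 have a': "a powr (1 - \<beta>2) \<le> 1 / (8 * k2)" by linarith
  \<comment> \<open>\<open>\<eta> powr (- \<beta>2)\<close> contributes the power
    \<open>b * \<beta>2\<close> of \<open>max 1 x\<close>; the 5 further powers are split off
    afterwards as the decay factor.\<close>
  obtain C0 where C0: "C0 > 0" "\<And>x. x \<ge> 0 \<Longrightarrow> max 1 x powr (b * \<beta>2 + 5) * exp (- x) \<le> C0"
    using ex_max_powr_exp_bound by blast
  define C where "C = 2 * k2 * exp 1 * a powr (- \<beta>2) * C0"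
  show ?thesis
  proof (rule that[of C])
    show "C > 0" using a exponents C0 by (simp add: C_def)
    fix r p t H
    assume dens: "is_density r p" and t: "t > 0" and H: "H \<ge> 0" "\<And>s. 0 < s \<Longrightarrow> s < t \<Longrightarrow> s * p s \<le> H"
      and id: "ennreal (t * p t) = ennreal r * (\<integral>\<^sup>+s. ennreal (w s * p (t - s)) \<partial>lborel)"
    note r = r_pos[OF dens]
    define x where "x = r * \<phi> (1 / t)"
    define y where "y = max 1 x"
    define \<eta> where "\<eta> = a * y powr (- b)"
    have x: "x > 0" using r t phi_pos by (simp add: x_def)
    have y: "y \<ge> 1" by (simp add: y_def)
    have y': "y powr (- b) \<le> 1" using y b powr_mono[of "- b" 0 y] by simp
    have e: "0 < \<eta>" using a y by (simp add: \<eta>_def)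
    have e2: "\<eta> \<le> 1 / 2" using mult_mono[OF a(2) y'] a by (simp add: \<eta>_def)
    have "t * p t \<le> r * (2 * \<phi> (1 / (\<eta> * t)) * exp (1 - r * \<phi> (1 / t)) + 2 * H / t * (2 * (\<eta> * t) * \<phi> (1 / (\<eta> * t))))"
    proof (rule upper_step[OF dens id t])
      show "0 < \<eta> * t" "0 \<le> 2 * H / t" using e t H by auto
      fix s assume s: "s \<in> {t - \<eta> * t..<t}"
      have "\<eta> * t \<le> t / 2" using e2 t by simp
      then have s2: "t / 2 \<le> s" using s by simp
      have "t / 2 * p s \<le> s * p s" using s2 p_nonneg[OF dens] by (intro mult_right_mono) auto
      also have "\<dots> \<le> H" using s s2 t by (intro H) auto
      finally show "p s \<le> 2 * H / t" using t by (simp add: field_simps)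
    qed
    also have "\<dots> = r * \<phi> (1 / (\<eta> * t)) * (2 * exp (1 - x) + 4 * H * \<eta>)"
      using t by (simp add: x_def algebra_simps)
    also have "\<dots> \<le> r * (k2 * \<eta> powr (- \<beta>2) * \<phi> (1 / t)) * (2 * exp (1 - x) + 4 * H * \<eta>)"
      using r H e e2 t by (intro mult_right_mono mult_left_mono phi_div_le add_nonneg_nonneg) auto
    also have "\<dots> = k2 * x * (2 * exp 1 * (\<eta> powr (- \<beta>2) * exp (- x)) + 4 * H * \<eta> powr (1 - \<beta>2))"
      using e by (simp add: x_def exp_diff exp_minus powr_diff powr_minus field_simps)
    also have "\<dots> \<le> k2 * x * (2 * exp 1 * (a powr (- \<beta>2) * C0 * y powr (- 5)) + 4 * H * (1 / (8 * k2) * y powr (- 5)))"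
    proof (intro mult_left_mono add_mono)
      have "\<eta> powr (- \<beta>2) * exp (- x) = a powr (- \<beta>2) * (y powr (b * \<beta>2) * exp (- x))"
        using a y by (simp add: \<eta>_def powr_mult powr_powr)
      also have "y powr (b * \<beta>2) * exp (- x) = y powr (b * \<beta>2 + 5) * exp (- x) * y powr (- 5)"
        using y by (simp add: powr_add powr_minus field_simps)
      also have "a powr (- \<beta>2) * \<dots> \<le> a powr (- \<beta>2) * (C0 * y powr (- 5))"
        using C0(2)[of x] x by (intro mult_left_mono mult_right_mono) (auto simp: y_def)
      finally show "\<eta> powr (- \<beta>2) * exp (- x) \<le> a powr (- \<beta>2) * C0 * y powr (- 5)" by (simp add: mult.assoc)
      have "\<eta> powr (1 - \<beta>2) = a powr (1 - \<beta>2) * y powr (- (b * (1 - \<beta>2)))"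
        using a y by (simp add: \<eta>_def powr_mult powr_powr)
      also have "\<dots> \<le> 1 / (8 * k2) * y powr (- 5)"
        unfolding b using a' by (intro mult_right_mono) auto
      finally show "\<eta> powr (1 - \<beta>2) \<le> 1 / (8 * k2) * y powr (- 5)" .
    qed (use x exponents H(1) in auto)
    also have "\<dots> = (C + H / 2) * (x * y powr (- 5))"
      using exponents by (simp add: C_def field_simps)
    finally show "t * p t \<le> (C + H / 2) * (r * \<phi> (1 / t) * max 1 (r * \<phi> (1 / t)) powr (- 5))"
      by (simp add: x_def y_def)
  qed
qed

text \<open>\<open>upper_improve\<close> is used twice. With \<open>H\<close> the supremum over a
  bounded interval and the decay factor estimated by 1, it gives \<open>H \<le> C + H / 2\<close>,
  hence \<open>H \<le> 2 * C\<close>. With \<open>2 * C\<close> in place of \<open>H\<close>, it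
  returns the same constant \<open>2 * C\<close>, now together with the decay factor.\<close>

lemma density_upper:
  obtains C where "C > 0"
    "\<And>r p t. is_density r p \<Longrightarrow> t > 0 \<Longrightarrow> t * p t \<le> C * (r * \<phi> (1 / t) * max 1 (r * \<phi> (1 / t)) powr (- 5))"
proof (rule upper_improve)
  fix C assume C: "C > 0" and imp: "\<And>r p t H. is_density r p \<Longrightarrow> t > 0 \<Longrightarrow> H \<ge> 0 \<Longrightarrow> (\<And>s. 0 < s \<Longrightarrow> s < t \<Longrightarrow> s * p s \<le> H) \<Longrightarrow>
       ennreal (t * p t) = ennreal r * (\<integral>\<^sup>+s. ennreal (w s * p (t - s)) \<partial>lborel) \<Longrightarrow>
       t * p t \<le> (C + H / 2) * (r * \<phi> (1 / t) * max 1 (r * \<phi> (1 / t)) powr (- 5))"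
  show ?thesis
  proof (rule that[of "2 * C"])
    fix r p t0
    assume dens: "is_density r p" and t0: "t0 > (0::real)"
    note r = r_pos[OF dens]
    define m where "m t = r * \<phi> (1 / t) * max 1 (r * \<phi> (1 / t)) powr (- 5)" for t
    have m1: "m t \<le> 1" if "t > 0" for t
    proof -
      define x where "x = r * \<phi> (1 / t)"
      have x: "x > 0" using r that phi_pos by (simp add: x_def)
      have "x * max 1 x powr (- 5) \<le> max 1 x * max 1 x powr (- 5)" by (intro mult_right_mono) auto
      also have "\<dots> = max 1 x powr (- 4)" using powr_mult_base[of "max 1 x" "-5"] by simp
      also have "\<dots> \<le> max 1 x powr 0" by (intro powr_mono) auto
      finally show ?thesis by (simp add: m_def x_def split: if_splits)
    qed
    have m_cont: "continuous_on {0<..} m"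
      unfolding m_def by (intro continuous_intros phi_continuous) auto
    have h_cont: "continuous_on {0<..} (\<lambda>t. t * p t)"
      using p_continuous[OF dens] by (intro continuous_intros)
    have all: "t * p t \<le> 2 * C" if t: "t > 0" for t
    proof -
      \<comment> \<open>Any endpoint beyond \<open>t\<close> would do; a finite one makes the
        supremum finite, because \<open>p\<close> is bounded.\<close>
      define T where "T = t + 1"
      define H where "H = (SUP s\<in>{0<..<T}. s * p s)"
      obtain B where B: "\<And>s. p s \<le> B" using p_bounded[OF dens] by blast
      have bdd: "bdd_above ((\<lambda>s. s * p s) ` {0<..<T})"
      proof (rule bdd_aboveI2)
        fix s assume "s \<in> {0<..<T}"
        then show "s * p s \<le> T * B" using B[of s] p_nonneg[OF dens, of s] by (intro mult_mono) auto
      qed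
      have H: "s * p s \<le> H" if "0 < s" "s < T" for s
        unfolding H_def using that by (intro cSUP_upper bdd) auto
      have H0: "H \<ge> 0" using H[of t] t p_nonneg[OF dens, of t] by (simp add: T_def) (meson mult_nonneg_nonneg less_imp_le order_trans)
      have "s * p s \<le> C + H / 2" if s: "s \<in> {0<..<T}" for s
      proof (rule AE_le_imp_le_on_open[where U = "{0<..<T}" and f = "\<lambda>s. s * p s" and g = "\<lambda>s. C + H / 2"])
        show "continuous_on {0<..<T} (\<lambda>s. s * p s)" by (rule continuous_on_subset[OF h_cont]) auto
        show "AE s in lborel. s \<in> {0<..<T} \<longrightarrow> s * p s \<le> C + H / 2"
          using density_identity[OF dens]
        proof eventually_elim
          case (elim s)
          show ?case
          proof
            assume s: "s \<in> {0<..<T}"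
            have "s * p s \<le> (C + H / 2) * m s"
              unfolding m_def using s H0 H by (intro imp[OF dens]) (auto simp: elim)
            also have "\<dots> \<le> (C + H / 2) * 1" using m1[of s] s C H0 by (intro mult_left_mono) auto
            finally show "s * p s \<le> C + H / 2" by simp
          qed
        qed
      qed (use s in auto)
      then have "H \<le> C + H / 2" unfolding H_def using t by (intro cSUP_least) (auto simp: T_def)
      then show ?thesis using H[of t] t by (simp add: T_def)
    qed
    have "t0 * p t0 \<le> 2 * C * m t0"
    proof (rule AE_le_imp_le_on_open[where U = "{0<..}" and f = "\<lambda>s. s * p s" and g = "\<lambda>s. 2 * C * m s"])
      show "AE s in lborel. s \<in> {0<..} \<longrightarrow> s * p s \<le> 2 * C * m s"
        using density_identity[OF dens]
      proof eventually_elim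
        case (elim s)
        show ?case
        proof
          assume s: "s \<in> {0<..}"
          have "s * p s \<le> (C + (2 * C) / 2) * m s"
            unfolding m_def using s C all by (intro imp[OF dens]) (auto simp: elim)
          then show "s * p s \<le> 2 * C * m s" by simp
        qed
      qed
    qed (use t0 in \<open>auto intro!: h_cont m_cont continuous_intros\<close>)
    then show "t0 * p t0 \<le> 2 * C * (r * \<phi> (1 / t0) * max 1 (r * \<phi> (1 / t0)) powr (- 5))"
      by (simp add: m_def)
  qed (use C in auto)
qed

lemma density_lower:
  obtains c where "c > 0"
    "\<And>r p t. is_density r p \<Longrightarrow> t > 0 \<Longrightarrow> r * \<phi> (1 / t) \<le> 1 / 8 \<Longrightarrow> c * (r * \<phi> (1 / t)) \<le> t * p t"
proof -
  obtain c where c: "c > 0" "\<And>t. t > 0 \<Longrightarrow> c * \<phi> (1 / t) \<le> w t" using w_ge by blast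
  show ?thesis
  proof (rule that[of "c / 2"])
    fix r p t0
    assume dens: "is_density r p" and t0: "t0 > 0" "r * \<phi> (1 / t0) \<le> 1 / 8"
    note r = r_pos[OF dens]
    \<comment> \<open>Passing from almost all times to \<open>t0\<close> needs an open set. The gap
      between 1/8 in the claim and 1/4 in \<open>lower_step\<close> puts \<open>t0\<close> inside
      it.\<close>
    define U where "U = {0<..} \<inter> (\<lambda>t. r * \<phi> (1 / t)) -` {..<1/4}"
    have U: "open U" unfolding U_def
      by (auto intro!: continuous_open_preimage continuous_intros phi_continuous)
    have "c / 2 * (r * \<phi> (1 / t0)) \<le> t0 * p t0"
    proof (rule AE_le_imp_le_on_open[where U = U and g = "\<lambda>s. s * p s" and f = "\<lambda>t. c / 2 * (r * \<phi> (1 / t))", OF U])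
      show "continuous_on U (\<lambda>t. c / 2 * (r * \<phi> (1 / t)))" "continuous_on U (\<lambda>s. s * p s)"
        using phi_continuous p_continuous[OF dens]
        by (auto intro!: continuous_intros elim!: continuous_on_subset simp: U_def)
      show "AE s in lborel. s \<in> U \<longrightarrow> c / 2 * (r * \<phi> (1 / s)) \<le> s * p s"
        using density_identity[OF dens]
      proof eventually_elim
        case (elim s)
        show ?case
        proof
          assume s: "s \<in> U"
          have "c / 2 * (r * \<phi> (1 / s)) = r * (c * \<phi> (1 / s)) / 2" by simp
          also have "\<dots> \<le> r * w s / 2" using c(2)[of s] s r by (intro divide_right_mono mult_left_mono) (auto simp: U_def)
          also have "\<dots> \<le> s * p s" using s by (intro lower_step[OF dens elim]) (auto simp: U_def)
          finally show "c / 2 * (r * \<phi> (1 / s)) \<le> s * p s" .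
        qed
      qed
      show "t0 \<in> U" using t0 by (auto simp: U_def)
    qed
    then show "c / 2 * (r * \<phi> (1 / t0)) \<le> t0 * p t0" .
  qed (use c in auto)
qed

text \<open>In terms of \<open>T\<close> the variable \<open>r * \<phi> (1 / t)\<close> is
  \<open>r / T\<close>, and \<open>max 1 (r / T)\<close> is resolved by comparing \<open>r\<close>
  with \<open>T\<close>. The common factor \<open>1 / (t * T)\<close> is pulled out because it does
  not depend on the mixing variable \<open>r\<close>.\<close>

lemma density_bounds:
  obtains c C where "c > 0" "C > 0"
    "\<And>r p t T. is_density r p \<Longrightarrow> t > 0 \<Longrightarrow> T = 1 / \<phi> (1 / t) \<Longrightarrow> r \<le> T \<Longrightarrow> p t \<le> C / (t * T) * r"
    "\<And>r p t T. is_density r p \<Longrightarrow> t > 0 \<Longrightarrow> T = 1 / \<phi> (1 / t) \<Longrightarrow> T < r \<Longrightarrow> p t \<le> C / (t * T) * (T ^ 5 / r ^ 4)"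
    "\<And>r p t T. is_density r p \<Longrightarrow> t > 0 \<Longrightarrow> T = 1 / \<phi> (1 / t) \<Longrightarrow> r \<le> 1 / 8 * T \<Longrightarrow> c / (t * T) * r \<le> p t"
proof (rule density_upper, rule density_lower)
  fix C c :: real
  assume C: "C > 0" and c: "c > 0"
    and up: "\<And>r p t. is_density r p \<Longrightarrow> t > 0 \<Longrightarrow> t * p t \<le> C * (r * \<phi> (1 / t) * max 1 (r * \<phi> (1 / t)) powr (- 5))"
    and low: "\<And>r p t. is_density r p \<Longrightarrow> t > 0 \<Longrightarrow> r * \<phi> (1 / t) \<le> 1 / 8 \<Longrightarrow> c * (r * \<phi> (1 / t)) \<le> t * p t"
  show ?thesis
  proof (rule that[OF c C])
    fix r p t T
    assume dens: "is_density r p" and t: "t > 0" and T: "T = 1 / \<phi> (1 / t)"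
    have p: "\<phi> (1 / t) > 0" using t phi_pos by simp
    have T0: "T > 0" "\<phi> (1 / t) = 1 / T" using p T by auto
    have r: "r > 0" by (rule r_pos[OF dens])
    show "p t \<le> C / (t * T) * r" if "r \<le> T"
    proof -
      have "t * p t \<le> C * (r / T)"
        using up[OF dens t] that T0 by (simp add: max_def field_simps split: if_splits)
      then show ?thesis using t T0 by (simp add: field_simps)
    qed
    show "p t \<le> C / (t * T) * (T ^ 5 / r ^ 4)" if "T < r"
    proof -
      have rT: "r / T \<ge> 1" using that T0 by simp
      have "r / T * max 1 (r / T) powr (- 5) = r / T * (1 / (r / T) ^ 5)"
        using rT r T0 by (simp add: powr_minus_divide max_absorb2 flip: powr_numeral)
      also have "\<dots> = T ^ 4 / r ^ 4" using r T0 by (simp add: field_simps power_def numeral_eq_Suc)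
      finally have "t * p t \<le> C * (T ^ 4 / r ^ 4)"
        using up[OF dens t] T0 by simp
      then have "p t \<le> C * (T ^ 4 / r ^ 4) / t"
        using t by (simp only: pos_le_divide_eq mult.commute[of "p t" t])
      also have "\<dots> = C / (t * T) * (T ^ 5 / r ^ 4)" using T0 t r by (simp add: power_def numeral_eq_Suc)
      finally show ?thesis .
    qed
    show "c / (t * T) * r \<le> p t" if "r \<le> 1 / 8 * T"
    proof -
      have "c * (r / T) \<le> t * p t" using low[OF dens t] that T0 by (simp add: field_simps)
      then show ?thesis using t T0 by (simp add: field_simps)
    qed
  qed
qed

end

section \<open>Mixtures of the kernel bound\<close>

lemma nn_integral_ge_const:
  fixes F :: "real \<Rightarrow> ennreal"
  assumes "\<And>r. r \<in> {u..v} \<Longrightarrow> ennreal K \<le> F r" "u \<le> v" "K \<ge> 0" "{u..v} \<subseteq> A"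
  shows "ennreal (K * (v - u)) \<le> (\<integral>\<^sup>+r\<in>A. F r \<partial>lborel)"
proof -
  have "ennreal (K * (v - u)) = (\<integral>\<^sup>+r\<in>{u..v}. ennreal K \<partial>lborel)"
    using assms by (simp add: nn_integral_cmult_indicator ennreal_mult)
  also have "\<dots> \<le> (\<integral>\<^sup>+r\<in>A. F r \<partial>lborel)"
    using assms by (intro nn_integral_mono) (auto split: split_indicator)
  finally show ?thesis .
qed

lemma nn_integral_le_const:
  fixes F :: "real \<Rightarrow> ennreal"
  assumes "\<And>r. r \<in> A \<Longrightarrow> F r \<le> ennreal K" "A \<subseteq> {u..v}" "u \<le> v" "K \<ge> 0"
  shows "(\<integral>\<^sup>+r\<in>A. F r \<partial>lborel) \<le> ennreal (K * (v - u))"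
proof -
  have "(\<integral>\<^sup>+r\<in>A. F r \<partial>lborel) \<le> (\<integral>\<^sup>+r\<in>{u..v}. ennreal K \<partial>lborel)"
    using assms by (intro nn_integral_mono) (auto split: split_indicator)
  also have "\<dots> = ennreal (K * (v - u))"
    using assms by (simp add: nn_integral_cmult_indicator ennreal_mult)
  finally show ?thesis .
qed

lemma nn_integral_powr_tail:
  fixes T :: real
  assumes "T > 0" "n \<ge> 1"
  shows "(\<integral>\<^sup>+r\<in>{T..}. ennreal (1 / r ^ Suc n) \<partial>lborel) = ennreal (1 / (real n * T ^ n))"
proof -
  have "(\<integral>\<^sup>+r\<in>{T..}. ennreal (1 / r ^ Suc n) \<partial>lborel) = ennreal (0 - (- 1 / (real n * T ^ n)))"
  proof (rule nn_integral_FTC_atLeast[where F = "\<lambda>r. - 1 / (real n * r ^ n)"])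
    fix x :: real assume x: "T \<le> x"
    have "((\<lambda>r. - (1 / real n) * inverse (r ^ n)) has_real_derivative
            - (1 / real n) * (- (inverse (x ^ n) * (real n * x ^ (n - 1)) * inverse (x ^ n)))) (at x)"
      using x assms by (auto intro!: derivative_eq_intros)
    also have "- (1 / real n) * (- (inverse (x ^ n) * (real n * x ^ (n - 1)) * inverse (x ^ n))) = 1 / x ^ Suc n"
    proof -
      obtain k where "n = Suc k" using assms by (cases n) auto
      moreover have "real n \<noteq> 0" "x \<noteq> 0" using assms x by auto
      ultimately show ?thesis by (simp add: divide_simps del: of_nat_Suc)
    qed
    also have "(\<lambda>r. - (1 / real n) * inverse (r ^ n)) = (\<lambda>r. - 1 / (real n * r ^ n))"
      by (auto simp: field_simps)
    finally show "((\<lambda>r. - 1 / (real n * r ^ n)) has_real_derivative 1 / x ^ Suc n) (at x)" .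
    show "0 \<le> 1 / x ^ Suc n" using x assms by simp
  next
    have "LIM x at_top. real n * x ^ n :> (at_top :: real filter)"
      using assms by (intro filterlim_tendsto_pos_mult_at_top[OF tendsto_const] filterlim_pow_at_top filterlim_ident) auto
    then show "((\<lambda>r. - 1 / (real n * r ^ n)) \<longlongrightarrow> 0) at_top"
      by (intro tendsto_divide_0[OF tendsto_const] filterlim_at_top_imp_at_infinity)
  qed simp
  then show ?thesis by simp
qed

text \<open>The point \<open>x\<close> is fixed here and hidden in \<open>g\<close>. The parameter
  \<open>D\<close> stands outside \<open>g\<close>, so that one value can serve all points and the
  final constants are uniform in \<open>x\<close>.\<close>

locale profile =
  fixes g :: "real \<Rightarrow> real" and D :: real
  assumes g_pos: "\<And>r. r > 0 \<Longrightarrow> g r > 0"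
    and g_antimono: "\<And>r s. 0 < r \<Longrightarrow> r \<le> s \<Longrightarrow> g s \<le> g r"
    and g_doubling: "\<And>r. r > 0 \<Longrightarrow> g r \<le> D * g (2 * r)"
    and g_measurable [measurable]: "g \<in> borel_measurable borel"
begin

text \<open>For \<open>a = \<Phi>(d(x,y))\<close> and \<open>g r = 1 / V(x, \<Phi>\<^sup>-\<^sup>1(r))\<close> one has \<open>g a = 1 / V(x, d(x,y))\<close>, so \<open>J a r\<close> is the
  comparison kernel for \<open>p0(r,x,y)\<close>; \<open>a = 0\<close> is the diagonal.\<close>

definition J :: "real \<Rightarrow> real \<Rightarrow> real" where
  "J a r = (if a = 0 then g r else min (g r) (r * g a / a))"

lemma D_pos: "D > 0"
  using g_pos[of 1] g_pos[of 2] g_doubling[of 1] by (auto simp: zero_less_mult_iff dest: order.strict_trans2)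

lemma J_pos: "a \<ge> 0 \<Longrightarrow> r > 0 \<Longrightarrow> J a r > 0"
  using g_pos[of a] g_pos[of r] by (auto simp: J_def)

lemma J_le: "J a r \<le> g r"
  by (auto simp: J_def)

lemma J_le': "a > 0 \<Longrightarrow> J a r \<le> r * g a / a"
  by (auto simp: J_def)

text \<open>The two terms of the minimum agree at \<open>r = a\<close>, where one decreases and the
  other increases. So the comparison of \<open>r\<close> with \<open>a\<close> decides the minimum,
  here and in \<open>J_above\<close>.\<close>

lemma J_below: "0 < r \<Longrightarrow> r \<le> a \<Longrightarrow> J a r = r * g a / a"
proof -
  assume r: "0 < r" "r \<le> a"
  have "r * g a / a \<le> 1 * g a"
    using r g_pos[of a] by (simp add: field_simps)
  also have "\<dots> \<le> g r" using r g_antimono[of r a] by simp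
  finally show ?thesis using r by (auto simp: J_def)
qed

lemma J_above: "0 \<le> a \<Longrightarrow> 0 < r \<Longrightarrow> a \<le> r \<Longrightarrow> J a r = g r"
proof -
  assume r: "0 \<le> a" "0 < r" "a \<le> r"
  { assume a: "a > 0"
    have "g r \<le> 1 * g a" using a r g_antimono[of a r] by simp
    also have "\<dots> \<le> r * g a / a"
      using r a g_pos[of a] by (simp add: field_simps)
    finally have ?thesis using r by (auto simp: J_def) }
  then show ?thesis using r by (auto simp: J_def)
qed

definition I :: "real \<Rightarrow> real \<Rightarrow> ennreal" where
  "I a b = (\<integral>\<^sup>+r\<in>{a..b}. ennreal (r * g r) \<partial>lborel)"

section \<open>Estimates of the comparison integral and of the mixtures\<close>

lemma I_ge:
  assumes "0 < u" "u \<le> v" "{u..v} \<subseteq> {a..b}"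
  shows "ennreal (u * g v * (v - u)) \<le> I a b"
  unfolding I_def
proof (rule nn_integral_ge_const)
  fix r assume r: "r \<in> {u..v}"
  have "g v \<le> g r" using r assms by (intro g_antimono) auto
  moreover have "g v > 0" using assms by (intro g_pos) auto
  ultimately show "ennreal (u * g v) \<le> ennreal (r * g r)"
    using r assms by (intro ennreal_leI mult_mono) auto
qed (use assms g_pos[of v] in auto)

lemma I_le:
  assumes "0 < a" "a \<le> b"
  shows "I a b \<le> ennreal (b * g a * (b - a))"
  unfolding I_def
proof (rule nn_integral_le_const)
  fix r assume r: "r \<in> {a..b}"
  have "g r \<le> g a" using r assms by (intro g_antimono) auto
  moreover have "g r > 0" using r assms by (intro g_pos) auto
  ultimately show "ennreal (r * g r) \<le> ennreal (b * g a)"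
    using r assms by (intro ennreal_leI mult_mono) auto
qed (use assms g_pos[of a] in auto)

lemma I_split: "I a b \<le> I a c + I c b"
proof -
  have "I a b \<le> (\<integral>\<^sup>+r. ennreal (r * g r) * indicator {a..c} r + ennreal (r * g r) * indicator {c..b} r \<partial>lborel)"
    unfolding I_def by (intro nn_integral_mono) (auto split: split_indicator)
  also have "\<dots> = I a c + I c b"
    unfolding I_def by (intro nn_integral_add) auto
  finally show ?thesis .
qed

text \<open>For \<open>T \<le> a\<close> the linear bound \<open>J a r \<le> r * g a / a\<close> is
  used for all \<open>r\<close>. The integrand is then at most \<open>K * T^2\<close> up to
  \<open>T\<close> and \<open>K * T^5 / r^3\<close> beyond it, with integrals at most
  \<open>K * T^3\<close> and \<open>K * T^3 / 2\<close>.\<close>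

lemma far_upper:
  assumes T: "T > 0" "T \<le> a" and C: "C > 0"
    and F1: "\<And>r. 0 < r \<Longrightarrow> r \<le> T \<Longrightarrow> F r \<le> ennreal (C * J a r * r)"
    and F2: "\<And>r. T < r \<Longrightarrow> F r \<le> ennreal (C * J a r * (T ^ 5 / r ^ 4))"
  shows "(\<integral>\<^sup>+r\<in>{0<..}. F r \<partial>lborel) \<le> ennreal (2 * C * T ^ 3 * g a / a)"
proof -
  have ga: "g a > 0" using T by (intro g_pos) auto
  define K where "K = C * g a / a"
  have K: "K > 0" using ga T C by (simp add: K_def)
  have "(\<integral>\<^sup>+r\<in>{0<..}. F r \<partial>lborel) \<le>
     (\<integral>\<^sup>+r. ennreal (K * T ^ 2) * indicator {0..T} r + ennreal (K * T ^ 5) * (ennreal (1 / r ^ Suc 2) * indicator {T..} r) \<partial>lborel)"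
  proof (intro nn_integral_mono)
    fix r :: real
    consider "r \<le> 0" | "0 < r" "r \<le> T" | "T < r" by linarith
    then show "F r * indicator {0<..} r \<le> ennreal (K * T ^ 2) * indicator {0..T} r + ennreal (K * T ^ 5) * (ennreal (1 / r ^ Suc 2) * indicator {T..} r)"
    proof cases
      case 2
      have "C * J a r * r \<le> C * (r * g a / a) * r"
        using 2 T C J_le'[of a r] by (intro mult_right_mono mult_left_mono) auto
      also have "\<dots> = K * r ^ 2" by (simp add: K_def power2_eq_square)
      also have "\<dots> \<le> K * T ^ 2" using 2 K by (intro mult_left_mono power_mono) auto
      finally have "F r \<le> ennreal (K * T ^ 2)" using F1[OF 2] by (meson ennreal_leI order_trans)
      then show ?thesis using 2 by (auto intro!: order_trans[OF _ add_increasing2])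
    next
      case 3
      then have r: "r > 0" using T by simp
      have "C * J a r * (T ^ 5 / r ^ 4) \<le> C * (r * g a / a) * (T ^ 5 / r ^ 4)"
        using 3 T C J_le'[of a r] by (intro mult_right_mono mult_left_mono) auto
      also have "\<dots> = K * T ^ 5 * (1 / r ^ Suc 2)" using r T by (simp add: K_def power_def numeral_eq_Suc)
      finally have "F r \<le> ennreal (K * T ^ 5) * ennreal (1 / r ^ Suc 2)"
        using F2[OF 3] K T r by (subst ennreal_mult[symmetric]) (auto intro: order_trans ennreal_leI)
      then show ?thesis using 3 T by (auto intro!: order_trans[OF _ add_increasing])
    qed auto
  qed
  also have "\<dots> = ennreal (K * T ^ 2) * ennreal T + ennreal (K * T ^ 5) * ennreal (1 / (real 2 * T ^ 2))"
    using T nn_integral_powr_tail[of T 2]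
    by (subst nn_integral_add) (auto simp: nn_integral_cmult nn_integral_cmult_indicator simp del: power_Suc)
  also have "\<dots> = ennreal (K * T ^ 2 * T + K * T ^ 5 * (1 / (real 2 * T ^ 2)))"
    using K T by (simp add: ennreal_mult[symmetric] ennreal_plus[symmetric] del: ennreal_plus)
  also have "\<dots> \<le> ennreal (2 * C * T ^ 3 * g a / a)"
  proof (rule ennreal_leI)
    have "K * T ^ 2 * T + K * T ^ 5 * (1 / (real 2 * T ^ 2)) = (3/2) * (K * T ^ 3)"
      using T by (simp add: power_def numeral_eq_Suc)
    also have "\<dots> \<le> 2 * (K * T ^ 3)" using K T by (intro mult_right_mono) auto
    also have "\<dots> = 2 * C * T ^ 3 * g a / a" by (simp add: K_def)
    finally show "K * T ^ 2 * T + K * T ^ 5 * (1 / (real 2 * T ^ 2)) \<le> 2 * C * T ^ 3 * g a / a" .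
  qed
  finally show ?thesis .
qed

text \<open>The window \<open>{b/2..b}\<close> lies below \<open>a\<close>, where \<open>J\<close>
  is linear in \<open>r\<close>. The parameter \<open>b\<close> is free because
  \<open>near_lower\<close> needs the estimate as well, with \<open>b\<close> below an
  \<open>a\<close> that may be smaller than \<open>T\<close>.\<close>

lemma far_lower:
  assumes T: "T > 0" and a: "b \<le> a" "0 < b" "b \<le> c0 * T" and C: "C > 0"
    and F: "\<And>r. 0 < r \<Longrightarrow> r \<le> c0 * T \<Longrightarrow> ennreal (C * J a r * r) \<le> F r"
  shows "ennreal (C * b ^ 3 / 8 * g a / a) \<le> (\<integral>\<^sup>+r\<in>{0<..}. F r \<partial>lborel)"
proof -
  have ga: "g a > 0" using a by (intro g_pos) auto
  have "ennreal (C * (b/2) ^ 2 * g a / a * (b - b/2)) \<le> (\<integral>\<^sup>+r\<in>{0<..}. F r \<partial>lborel)"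
  proof (rule nn_integral_ge_const)
    fix r assume r: "r \<in> {b/2..b}"
    then have "C * (b/2) ^ 2 * g a / a \<le> C * r ^ 2 * g a / a"
      using a C ga by (intro divide_right_mono mult_right_mono mult_left_mono power_mono) auto
    also have "\<dots> = C * J a r * r" using r a J_below[of r a] by (simp add: power2_eq_square)
    finally have "ennreal (C * (b/2) ^ 2 * g a / a) \<le> ennreal (C * J a r * r)" by (rule ennreal_leI)
    also have "\<dots> \<le> F r" using r a by (intro F) auto
    finally show "ennreal (C * (b/2) ^ 2 * g a / a) \<le> F r" .
  qed (use a C ga in auto)
  also have "C * (b/2) ^ 2 * g a / a * (b - b/2) = C * b ^ 3 / 8 * g a / a"
    by (simp add: power_def numeral_eq_Suc)
  finally show ?thesis .
qed

text \<open>The range between \<open>a\<close> and \<open>T\<close> gives the comparison integral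
  directly. The range below \<open>a\<close> contributes at most \<open>C * a^2 * g a\<close>, the
  tail at most \<open>C * T^2 * g T\<close>. By doubling both are at most \<open>C * D\<close> times
  the integral over \<open>{a..2 * a}\<close> and \<open>{T..2 * T}\<close> respectively, and these
  intervals lie in \<open>{a..2 * T}\<close> as \<open>a \<le> T\<close>.\<close>

lemma near_upper:
  assumes T: "T > 0" "0 \<le> a" "a \<le> T" and C: "C > 0"
    and F1: "\<And>r. 0 < r \<Longrightarrow> r \<le> T \<Longrightarrow> F r \<le> ennreal (C * J a r * r)"
    and F2: "\<And>r. T < r \<Longrightarrow> F r \<le> ennreal (C * J a r * (T ^ 5 / r ^ 4))"
  shows "(\<integral>\<^sup>+r\<in>{0<..}. F r \<partial>lborel) \<le> ennreal ((2 * D + 1) * C) * I a (2 * T)"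
proof -
  have gT: "g T > 0" using T by (intro g_pos) auto
  \<comment> \<open>Nothing is assumed about \<open>g 0\<close>; on the diagonal the range below
    \<open>a\<close> must contribute 0.\<close>
  define ga where "ga = (if a = 0 then 0 else g a)"
  have ga: "ga \<ge> 0" using g_pos[of a] T by (auto simp: ga_def)
  have "(\<integral>\<^sup>+r\<in>{0<..}. F r \<partial>lborel) \<le>
     (\<integral>\<^sup>+r. ennreal (C * (ga * a)) * indicator {0..a} r +
       (ennreal C * (ennreal (r * g r) * indicator {a..2*T} r) +
        ennreal (C * g T * T ^ 5) * (ennreal (1 / r ^ Suc 3) * indicator {T..} r)) \<partial>lborel)"
  proof (intro nn_integral_mono)
    fix r :: real
    consider "r \<le> 0" | "0 < r" "r \<le> a" | "0 < r" "a < r" "r \<le> T" | "T < r" by linarith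
    then show "F r * indicator {0<..} r \<le> ennreal (C * (ga * a)) * indicator {0..a} r +
       (ennreal C * (ennreal (r * g r) * indicator {a..2*T} r) +
        ennreal (C * g T * T ^ 5) * (ennreal (1 / r ^ Suc 3) * indicator {T..} r))"
    proof cases
      case 2
      then have a: "a > 0" by simp
      have "C * J a r * r = C * (r * ga / a) * r"
        using 2 by (simp add: J_below ga_def)
      also have "\<dots> \<le> C * (ga * a)"
      proof -
        have "r * ga / a \<le> ga" using 2 a mult_right_mono[of r a ga] ga by (simp add: field_simps)
        then have "C * (r * ga / a) * r \<le> C * ga * a" using 2 C a ga by (intro mult_mono) auto
        then show ?thesis by (simp add: mult.assoc)
      qed
      finally have "F r \<le> ennreal (C * (ga * a))" using F1[of r] 2 T
        by (meson ennreal_leI order_trans)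
      then show ?thesis using 2 by (auto intro!: order_trans[OF _ add_increasing2])
    next
      case 3
      have "C * J a r * r = C * (r * g r)" using 3 T by (simp add: J_above)
      then have "F r \<le> ennreal C * ennreal (r * g r)" using F1[of r] 3 C g_pos[of r] by (simp add: ennreal_mult mult_ac)
      then have "F r * indicator {0<..} r \<le> ennreal C * (ennreal (r * g r) * indicator {a..2*T} r)"
        using 3 T by simp
      then show ?thesis by (rule add_increasing[OF zero_le add_increasing2[OF zero_le]])
    next
      case 4
      then have r: "r > 0" using T by simp
      have "C * J a r * (T ^ 5 / r ^ 4) \<le> C * g T * (T ^ 5 / r ^ 4)"
        using 4 T C J_le[of a r] g_antimono[of T r] by (intro mult_right_mono mult_left_mono) auto
      also have "\<dots> = C * g T * T ^ 5 * (1 / r ^ Suc 3)" using r T by (simp add: power_def numeral_eq_Suc)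
      finally have "F r \<le> ennreal (C * g T * T ^ 5) * ennreal (1 / r ^ Suc 3)"
        using F2[OF 4] T r C gT by (subst ennreal_mult[symmetric]) (auto intro: order_trans ennreal_leI)
      then show ?thesis using 4 T by (auto intro!: add_increasing order_trans[OF _ add_increasing])
    qed auto
  qed
  also have "\<dots> = ennreal (C * (ga * a)) * ennreal a + (ennreal C * I a (2*T) + ennreal (C * g T * T ^ 5) * ennreal (1 / (real 3 * T ^ 3)))"
    using T nn_integral_powr_tail[of T 3] by (subst nn_integral_add, simp, simp, subst nn_integral_add)
      (auto simp: nn_integral_cmult nn_integral_cmult_indicator I_def simp del: power_Suc)
  also have "ennreal (C * (ga * a)) * ennreal a \<le> ennreal (C * D) * I a (2 * T)"
  proof (cases "a = 0")
    case False
    then have a: "a > 0" using T by simp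
    have "C * (ga * a) * a \<le> C * D * (a * g (2 * a) * (2 * a - a))"
      using g_doubling[of a] a C by (simp add: ga_def)
    then have "ennreal (C * (ga * a)) * ennreal a \<le> ennreal (C * D) * ennreal (a * g (2 * a) * (2 * a - a))"
      using a ga C D_pos g_pos[of "2*a"] by (subst (1 2) ennreal_mult[symmetric]) (auto intro: ennreal_leI)
    also have "\<dots> \<le> ennreal (C * D) * I a (2 * T)"
      using a T by (intro mult_left_mono I_ge) auto
    finally show ?thesis .
  qed auto
  also have "ennreal (C * g T * T ^ 5) * ennreal (1 / (real 3 * T ^ 3)) \<le> ennreal (C * D) * I a (2 * T)"
  proof -
    have "C * g T * T ^ 5 * (1 / (real 3 * T ^ 3)) = C * g T * T ^ 2 / 3"
      using T by (simp add: power_def numeral_eq_Suc)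
    also have "\<dots> \<le> C * g T * T ^ 2" using C gT by simp
    also have "\<dots> \<le> C * (D * g (2 * T)) * T ^ 2" using T C by (intro mult_right_mono mult_left_mono g_doubling) auto
    also have "\<dots> = C * D * (T * g (2 * T) * (2 * T - T))" by (simp add: power2_eq_square)
    finally have "ennreal (C * g T * T ^ 5) * ennreal (1 / (real 3 * T ^ 3)) \<le> ennreal (C * D) * ennreal (T * g (2 * T) * (2 * T - T))"
      using T gT C D_pos g_pos[of "2*T"] by (subst (1 2) ennreal_mult[symmetric]) (auto intro: ennreal_leI)
    also have "\<dots> \<le> ennreal (C * D) * I a (2 * T)"
      using T by (intro mult_left_mono I_ge) auto
    finally show ?thesis .
  qed
  also have "ennreal (C * D) * I a (2 * T) + (ennreal C * I a (2*T) + ennreal (C * D) * I a (2 * T))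
     = (ennreal (C * D) + (ennreal C + ennreal (C * D))) * I a (2 * T)"
    by (simp add: distrib_right)
  also have "ennreal (C * D) + (ennreal C + ennreal (C * D)) = ennreal ((2 * D + 1) * C)"
    using C D_pos by (simp add: ennreal_plus[symmetric] algebra_simps del: ennreal_plus)
  finally show ?thesis by (simp add: add_mono)
qed

text \<open>The density bound is available only up to \<open>c0 * T\<close>. If \<open>a\<close> is
  at most half of that, the integral over \<open>{a..c0 * T}\<close> already dominates the one up to
  \<open>2 * T\<close>. Otherwise \<open>a\<close> is comparable to \<open>T\<close>, the integral
  is at most \<open>4 * T^2 * g a\<close>, and \<open>far_lower\<close> with
  \<open>b = c0 * T / 2\<close> applies. The second case fixes the constant:
  \<open>256 = 4 * 64\<close>, where \<open>b^3 / 8 = c0^3 * T^3 / 64\<close>.\<close>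

lemma near_lower:
  assumes T: "T > 0" "0 \<le> a" "a \<le> T" and C: "C > 0" and c0: "0 < c0" "c0 \<le> 1"
    and F: "\<And>r. 0 < r \<Longrightarrow> r \<le> c0 * T \<Longrightarrow> ennreal (C * J a r * r) \<le> F r"
  shows "ennreal (C * c0 ^ 3 / 256) * I a (2 * T) \<le> (\<integral>\<^sup>+r\<in>{0<..}. F r \<partial>lborel)"
proof (cases "a \<le> c0 * T / 2")
  case True
  define b where "b = c0 * T"
  have b: "b > 0" "b \<le> T" "a \<le> b / 2" using T c0 True by (auto simp: b_def mult_left_le_one_le)
  have gb: "g b > 0" using b by (intro g_pos)
  have "I b (2 * T) \<le> ennreal (2 * T * g b * (2 * T - b))" using b by (intro I_le) auto
  \<comment> \<open>The factor is the quotient of \<open>(2 * T)^2\<close> and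
    \<open>(b / 2)^2\<close>; the window \<open>{b/2..b}\<close> lies in \<open>{a..b}\<close> in
    this case.\<close>
  also have "\<dots> \<le> ennreal (16 / c0^2) * ennreal (b/2 * g b * (b - b/2))"
  proof -
    have "2 * T * g b * (2 * T - b) \<le> 2 * T * g b * (2 * T)" using b T gb by (intro mult_left_mono) auto
    also have "\<dots> = 16 / c0^2 * (b/2 * g b * (b - b/2))"
      using c0 by (simp add: b_def power2_eq_square field_simps)
    finally show ?thesis using b gb by (subst ennreal_mult[symmetric]) (auto intro: ennreal_leI)
  qed
  also have "\<dots> \<le> ennreal (16 / c0^2) * I a b"
    using b by (intro mult_left_mono I_ge) auto
  finally have "I a (2 * T) \<le> I a b + ennreal (16 / c0^2) * I a b"
    using I_split[of a "2*T" b] by (meson add_left_mono order_trans)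
  also have "\<dots> = ennreal (1 + 16 / c0^2) * I a b" using c0 by (subst ennreal_plus) (auto simp: distrib_right)
  finally have "ennreal (C * c0^3 / 256) * I a (2 * T) \<le> ennreal (C * c0^3 / 256) * (ennreal (1 + 16 / c0^2) * I a b)"
    by (intro mult_left_mono) auto
  also have "\<dots> = ennreal (C * c0^3 / 256 * (1 + 16 / c0^2)) * I a b"
    using C c0 by (subst ennreal_mult) (auto simp: mult.assoc)
  also have "\<dots> \<le> ennreal C * I a b"
  proof (intro mult_right_mono ennreal_leI)
    have "c0 ^ 3 \<le> 1" using c0 by (intro power_le_one) auto
    moreover have "c0^3 * (1 + 16 / c0^2) = c0^3 + 16 * c0" using c0 by (simp add: power_def numeral_eq_Suc field_simps)
    ultimately have "c0^3 * (1 + 16 / c0^2) / 256 \<le> 1" using c0 by simp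
    then show "C * c0^3 / 256 * (1 + 16 / c0^2) \<le> C"
      using C mult_left_mono[of "c0^3 * (1 + 16 / c0^2) / 256" 1 C] by (simp add: mult.assoc)
  qed auto
  also have "\<dots> = (\<integral>\<^sup>+r\<in>{a..b}. ennreal (C * (r * g r)) \<partial>lborel)"
    unfolding I_def using C by (subst nn_integral_cmult[symmetric]) (auto simp: ennreal_mult' mult.assoc)
  also have "\<dots> \<le> (\<integral>\<^sup>+r\<in>{0<..}. F r \<partial>lborel)"
  proof (intro nn_integral_mono)
    fix r
    have "ennreal (C * (r * g r)) \<le> F r" if "a \<le> r" "r \<le> b" "r > 0"
      using F[of r] that J_above[of a r] T by (simp add: b_def mult_ac)
    moreover have "ennreal (C * (r * g r)) = 0" if "r = 0" using that by simp
    ultimately show "ennreal (C * (r * g r)) * indicator {a..b} r \<le> F r * indicator {0<..} r"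
      using T by (cases "r > 0"; cases "r = 0") (auto split: split_indicator)
  qed
  finally show ?thesis .
next
  case False
  define b where "b = c0 * T / 2"
  have b: "b > 0" "b \<le> a" "b \<le> c0 * T" using T c0 False by (auto simp: b_def)
  have a_pos: "a > 0" using b by simp
  have ga: "g a > 0" by (intro g_pos a_pos)
  have "I a (2 * T) \<le> ennreal (2 * T * g a * (2 * T - a))" using b T by (intro I_le) auto
  then have "ennreal (C * c0 ^ 3 / 256) * I a (2 * T) \<le> ennreal (C * c0 ^ 3 / 256) * ennreal (2 * T * g a * (2 * T - a))"
    by (intro mult_left_mono) auto
  also have "\<dots> \<le> ennreal (C * b ^ 3 / 8 * g a / a)"
  proof -
    have "2 * T * g a * (2 * T - a) * a \<le> 2 * T * g a * (2 * T) * T"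
      using b T ga by (intro mult_mono) auto
    then have "C * c0 ^ 3 / 256 * (2 * T * g a * (2 * T - a) * a) \<le> C * c0 ^ 3 / 256 * (2 * T * g a * (2 * T) * T)"
      using C c0 by (intro mult_left_mono) auto
    also have "\<dots> = C * b ^ 3 / 8 * g a" by (simp add: b_def power_def numeral_eq_Suc)
    finally have "C * c0 ^ 3 / 256 * (2 * T * g a * (2 * T - a)) \<le> C * b ^ 3 / 8 * g a / a"
      using pos_le_divide_eq[OF a_pos] by (simp only: mult.assoc)
    then show ?thesis using C c0 T b ga
      by (subst ennreal_mult[symmetric]) (auto intro!: ennreal_leI)
  qed
  also have "\<dots> \<le> (\<integral>\<^sup>+r\<in>{0<..}. F r \<partial>lborel)"
    using b T C F by (intro far_lower[where ?c0.0 = c0]) auto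
  finally show ?thesis .
qed

end

section \<open>Volume and scale function\<close>

locale volume_scale =
  fixes V :: "'a \<Rightarrow> real \<Rightarrow> real" and \<Phi> :: "real \<Rightarrow> real" and c2 d2 c3 \<alpha>1 :: real
  assumes V_pos: "\<And>x r. r > 0 \<Longrightarrow> V x r > 0"
    and V_mono: "\<And>x r R. 0 < r \<Longrightarrow> r \<le> R \<Longrightarrow> V x r \<le> V x R"
    and V_doubling: "\<And>x r R. 0 < r \<Longrightarrow> r \<le> R \<Longrightarrow> V x R \<le> c2 * (R / r) powr d2 * V x r"
    and c_pos: "c2 > 0" "c3 > 0" "\<alpha>1 > 0" "d2 > 0"
    and Phi_mono: "strict_mono_on {0..} \<Phi>" and Phi_0: "\<Phi> 0 = 0"
    and Phi_ge: "\<And>r R. 0 < r \<Longrightarrow> r \<le> R \<Longrightarrow> c3 * (R / r) powr \<alpha>1 * \<Phi> r \<le> \<Phi> R"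
begin

section \<open>The generalized inverse of \<Phi> and the profile of a point\<close>

lemma Phi_less_iff: "0 \<le> s \<Longrightarrow> 0 \<le> t \<Longrightarrow> \<Phi> s < \<Phi> t \<longleftrightarrow> s < t"
  using Phi_mono by (intro strict_mono_on_less) auto

lemma Phi_pos: "s > 0 \<Longrightarrow> \<Phi> s > 0"
  using Phi_less_iff[of 0 s] by (simp add: Phi_0)

lemma Phi_nonneg: "s \<ge> 0 \<Longrightarrow> \<Phi> s \<ge> 0"
  using Phi_pos[of s] by (cases "s = 0") (auto simp: Phi_0)

text \<open>Multiplying the argument by \<open>K\<close> multiplies \<Phi> by at least
  \<open>m\<close>. This yields that \<Phi> is unbounded, that it tends to 0 at 0, and, with
  \<open>m = 2\<close>, the doubling of \<open>g\<close>.\<close>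

lemma ex_scale_factor: obtains K where "K \<ge> 1" "c3 * K powr \<alpha>1 \<ge> m"
proof
  define K where "K = max 1 ((\<bar>m\<bar> / c3) powr (1 / \<alpha>1))"
  show "K \<ge> 1" by (simp add: K_def)
  have "\<bar>m\<bar> / c3 = ((\<bar>m\<bar> / c3) powr (1 / \<alpha>1)) powr \<alpha>1" using c_pos by (simp add: powr_powr)
  also have "\<dots> \<le> K powr \<alpha>1" using c_pos by (intro powr_mono2) (auto simp: K_def)
  finally have "\<bar>m\<bar> \<le> c3 * K powr \<alpha>1" using c_pos by (simp add: field_simps)
  then show "c3 * K powr \<alpha>1 \<ge> m" by linarith
qed

lemma right_inv_bdd: "bdd_below {s. 0 \<le> s \<and> t < \<Phi> s}"
  by (intro bdd_belowI[of _ 0]) auto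

lemma right_inv_nonempty: "{s. 0 \<le> s \<and> t < \<Phi> s} \<noteq> {}"
proof -
  obtain K where K: "K \<ge> 1" "c3 * K powr \<alpha>1 \<ge> (\<bar>t\<bar> + 1) / \<Phi> 1" by (rule ex_scale_factor)
  have "\<bar>t\<bar> + 1 \<le> c3 * (K / 1) powr \<alpha>1 * \<Phi> 1"
    using K Phi_pos[of 1] by (simp add: field_simps)
  also have "\<dots> \<le> \<Phi> K" using K by (intro Phi_ge) auto
  finally have "t < \<Phi> K" by linarith
  then show ?thesis using K by (auto intro!: exI[of _ K])
qed

lemma right_inv_mono: "s \<le> t \<Longrightarrow> right_inv \<Phi> s \<le> right_inv \<Phi> t"
  unfolding right_inv_def by (intro cInf_superset_mono right_inv_bdd right_inv_nonempty) auto

lemma right_inv_pos: assumes "t > 0" shows "right_inv \<Phi> t > 0"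
proof -
  obtain K where K: "K \<ge> 1" "c3 * K powr \<alpha>1 \<ge> \<Phi> 1 / t" by (rule ex_scale_factor)
  have "\<Phi> 1 / t * \<Phi> (1 / K) \<le> c3 * (1 / (1 / K)) powr \<alpha>1 * \<Phi> (1 / K)"
    using K Phi_pos[of "1/K"] by (intro mult_right_mono) auto
  also have "\<dots> \<le> \<Phi> 1" using K by (intro Phi_ge) auto
  finally have le: "\<Phi> (1 / K) \<le> t" using Phi_pos[of 1] assms by (simp add: field_simps)
  have "1 / K \<le> right_inv \<Phi> t"
    unfolding right_inv_def
  proof (intro cInf_greatest right_inv_nonempty)
    fix s assume s: "s \<in> {s. 0 \<le> s \<and> t < \<Phi> s}"
    then have "\<Phi> (1 / K) < \<Phi> s" using le by auto
    then show "1 / K \<le> s" using s K Phi_less_iff[of "1/K" s] by simp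
  qed
  moreover have "1 / K > 0" using K by simp
  ultimately show ?thesis by linarith
qed

text \<open>\<Phi> may jump, but by strict monotonicity the set in the infimum is exactly
  \<open>{d<..}\<close>.\<close>

lemma right_inv_Phi: assumes "d \<ge> 0" shows "right_inv \<Phi> (\<Phi> d) = d"
proof -
  have "{s. 0 \<le> s \<and> \<Phi> d < \<Phi> s} = {d<..}" using assms Phi_less_iff[of d] by force
  then show ?thesis by (simp add: right_inv_def)
qed

text \<open>The value 0 off the positive axis makes \<open>- g x\<close> monotone on each of two
  half-lines, which yields measurability although \<open>V x\<close> is unspecified at nonpositive
  radii.\<close>

definition g :: "'a \<Rightarrow> real \<Rightarrow> real" where
  "g x r = (if r > 0 then 1 / V x (right_inv \<Phi> r) else 0)"

text \<open>If \<Phi> at least doubles when its argument is multiplied by \<open>K\<close>, then its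
  inverse grows at most by the factor \<open>K\<close> from \<open>r\<close> to
  \<open>2 * r\<close>. Volume growth turns this into \<open>D = c2 * K powr d2\<close>, the same
  for all points.\<close>

lemma profile_g: obtains D where "\<And>x. profile (g x) D"
proof -
  obtain K where K: "K \<ge> 1" "c3 * K powr \<alpha>1 \<ge> 2" by (rule ex_scale_factor)
  have anti: "g x s \<le> g x r" if "0 < r" "r \<le> s" for x r s
    using that V_mono[OF right_inv_pos right_inv_mono, of r s x] V_pos[OF right_inv_pos, of r x] V_pos[OF right_inv_pos, of s x]
    by (simp add: g_def frac_le)
  show ?thesis
  proof (rule that[of "c2 * K powr d2"], unfold_locales)
    fix x r assume r: "r > (0::real)"
    then show "g x r > 0" by (simp add: g_def V_pos right_inv_pos)
    have "right_inv \<Phi> (2 * r) / K \<le> right_inv \<Phi> r"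
      unfolding right_inv_def[of \<Phi> r]
    proof (intro cInf_greatest right_inv_nonempty)
      fix s assume s: "s \<in> {s. 0 \<le> s \<and> r < \<Phi> s}"
      then have s0: "s > 0" using r Phi_0 by (cases "s = 0") auto
      have "2 * r < 2 * \<Phi> s" using s by simp
      also have "\<dots> \<le> c3 * (K * s / s) powr \<alpha>1 * \<Phi> s" using K s0 Phi_pos[of s] by (intro mult_right_mono) auto
      also have "\<dots> \<le> \<Phi> (K * s)" using K s0 by (intro Phi_ge) auto
      finally have "right_inv \<Phi> (2 * r) \<le> K * s"
        unfolding right_inv_def using K s0 by (intro cInf_lower right_inv_bdd) auto
      then show "right_inv \<Phi> (2 * r) / K \<le> s" using K by (simp add: field_simps)
    qed
    then have le: "right_inv \<Phi> (2 * r) / right_inv \<Phi> r \<le> K"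
      using K right_inv_pos[OF r] by (simp add: field_simps)
    have pos: "V x (right_inv \<Phi> r) > 0" "V x (right_inv \<Phi> (2 * r)) > 0" using r by (auto intro!: V_pos right_inv_pos)
    have "V x (right_inv \<Phi> (2 * r)) \<le> c2 * (right_inv \<Phi> (2 * r) / right_inv \<Phi> r) powr d2 * V x (right_inv \<Phi> r)"
      using r by (intro V_doubling right_inv_pos right_inv_mono) auto
    also have "\<dots> \<le> c2 * K powr d2 * V x (right_inv \<Phi> r)"
      using le pos c_pos right_inv_pos[of r] right_inv_pos[of "2*r"] r
      by (intro mult_right_mono mult_left_mono powr_mono2) auto
    finally show "g x r \<le> c2 * K powr d2 * g x (2 * r)" using r pos by (simp add: g_def field_simps)
  next
    fix x
    have "(\<lambda>r. - g x r) \<in> borel_measurable borel"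
    proof (rule borel_measurable_piecewise_mono[of "{{0<..}, {..0}}"])
      show "mono_on C (\<lambda>r. - g x r)" if "C \<in> {{0<..}, {..0}}" for C
        using that anti[of _ _ x] by (auto simp: mono_on_def g_def)
    qed auto
    then show "g x \<in> borel_measurable borel" by simp
  qed (use anti in auto)
qed

end

section \<open>Subordinated kernels\<close>

text \<open>\<open>laplace_exponent\<close> is a Bochner integral, which is 0 by convention for a
  nonintegrable integrand. Integrability of \<open>min 1 x\<close> under the Levy measure makes it
  equal to the \<open>ennreal\<close> integral of the locale.\<close>

lemma bernstein_scaling_laplace_exponent:
  fixes Nu :: "real measure" and \<nu> :: "real \<Rightarrow> real"
  assumes levy: "subordinator_levy_measure Nu"
    and scal: "\<And>l \<kappa>. l > 0 \<Longrightarrow> \<kappa> \<ge> 1 \<Longrightarrow>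
           k1 * \<kappa> powr \<beta>1 \<le> laplace_exponent Nu (\<kappa> * l) / laplace_exponent Nu l \<and>
           laplace_exponent Nu (\<kappa> * l) / laplace_exponent Nu l \<le> k2 * \<kappa> powr \<beta>2"
    and exps: "0 < \<beta>1" "\<beta>1 < \<beta>2" "\<beta>2 < 1" "k1 > 0" "k2 > 0"
    and [measurable]: "\<nu> \<in> borel_measurable borel" and nn: "\<And>z. z > 0 \<Longrightarrow> \<nu> z \<ge> 0"
    and Nu: "Nu = density lborel (\<lambda>z. ennreal (\<nu> z * indicator {0<..} z))"
    and anti: "antimono_on {0<..} (\<lambda>z. z * \<nu> z)"
  shows "bernstein_scaling (\<lambda>z. if z > 0 then z * \<nu> z else 0) (laplace_exponent Nu) k1 k2 \<beta>1 \<beta>2"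
proof -
  let ?w = "\<lambda>z. if z > 0 then z * \<nu> z else 0"
  have le: "laplace_exponent Nu l = (LINT x|Nu. indicator {0<..} x * (1 - exp (- (l * x))))" for l
    by (simp add: laplace_exponent_def set_lebesgue_integral_def)
  have nonneg: "0 \<le> indicator {0<..} x * (1 - exp (- (l * x)))" if "l > 0" for l x :: real
    using that by (auto split: split_indicator)
  have [measurable_cong]: "sets Nu = sets borel" by (simp add: Nu)
  have int: "integrable Nu (\<lambda>x. indicator {0<..} x * (1 - exp (- (l * x))))" if l: "l > 0" for l
  proof (rule integrableI_nonneg)
    have "(\<integral>\<^sup>+x. ennreal (indicator {0<..} x * (1 - exp (- (l * x)))) \<partial>Nu)
      \<le> (\<integral>\<^sup>+x. ennreal (max 1 l) * ennreal (min 1 x) \<partial>Nu)"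
    proof (intro nn_integral_mono)
      fix x
      have "1 - exp (- (l * x)) \<le> max 1 l * min 1 x" if x: "x > 0"
      proof (cases "x \<le> 1")
        case True
        have "1 - exp (- (l * x)) \<le> l * x" using exp_ge_add_one_self[of "- (l * x)"] by simp
        also have "\<dots> \<le> max 1 l * x" using x by (intro mult_right_mono) auto
        finally show ?thesis using True by simp
      next
        case False
        then have "max 1 l * min 1 x \<ge> 1" by simp
        then show ?thesis using exp_gt_zero[of "- (l * x)"] by linarith
      qed
      then show "ennreal (indicator {0<..} x * (1 - exp (- (l * x)))) \<le> ennreal (max 1 l) * ennreal (min 1 x)"
        using l by (auto simp: ennreal_mult''[symmetric] split: split_indicator intro!: ennreal_leI)
    qed
    also have "\<dots> = ennreal (max 1 l) * (\<integral>\<^sup>+x. ennreal (min 1 x) \<partial>Nu)" by (intro nn_integral_cmult) measurable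
    also have "\<dots> < \<infinity>"
      using levy by (auto simp: subordinator_levy_measure_def ennreal_mult_less_top)
    finally show "(\<integral>\<^sup>+x. ennreal (indicator {0<..} x * (1 - exp (- (l * x)))) \<partial>Nu) < \<infinity>" .
  qed (use nonneg[OF l] in auto)
  have eq: "(\<integral>\<^sup>+s. ennreal ((1 - exp (- (l * s))) * (?w s / s)) \<partial>lborel) = ennreal (laplace_exponent Nu l)" if l: "l > 0" for l
  proof -
    have "ennreal (laplace_exponent Nu l) = (\<integral>\<^sup>+x. ennreal (indicator {0<..} x * (1 - exp (- (l * x)))) \<partial>Nu)"
      unfolding le using int[OF l] nonneg[OF l] by (intro nn_integral_eq_integral[symmetric]) auto
    also have "\<dots> = (\<integral>\<^sup>+x. ennreal (\<nu> x * indicator {0<..} x) * ennreal (indicator {0<..} x * (1 - exp (- (l * x)))) \<partial>lborel)"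
      unfolding Nu by (intro nn_integral_density) auto
    also have "\<dots> = (\<integral>\<^sup>+s. ennreal ((1 - exp (- (l * s))) * (?w s / s)) \<partial>lborel)"
      using l nn by (intro nn_integral_cong) (auto simp: ennreal_mult[symmetric] mult.commute split: split_indicator)
    finally show ?thesis by simp
  qed
  have ge0: "laplace_exponent Nu l \<ge> 0" if "l > 0" for l
    unfolding le using nonneg[OF that] by (intro Bochner_Integration.integral_nonneg) auto
  \<comment> \<open>For \<open>\<kappa> = 1\<close> a zero of \<phi> would make the quotient 0,
    since division by 0 gives 0, against \<open>k1 > 0\<close>.\<close>
  have pos: "laplace_exponent Nu l > 0" if "l > 0" for l
    using scal[OF that, of 1] ge0[OF that] exps by (cases "laplace_exponent Nu l = 0") auto
  show ?thesis
  proof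
    fix l \<kappa> :: real assume l: "l > 0" and k: "\<kappa> \<ge> 1"
    show "k1 * \<kappa> powr \<beta>1 * laplace_exponent Nu l \<le> laplace_exponent Nu (\<kappa> * l)"
      "laplace_exponent Nu (\<kappa> * l) \<le> k2 * \<kappa> powr \<beta>2 * laplace_exponent Nu l"
      using scal[OF l k] pos[OF l] by (auto simp: pos_le_divide_eq pos_divide_le_eq)
  next
    fix s t :: real assume "0 < s" "s \<le> t"
    then show "?w t \<le> ?w s" using anti by (auto simp: monotone_on_def)
  qed (use exps nn pos eq in auto)
qed

text \<open>Values of \<open>pbar r\<close> are controlled at positive times only, hence the cut at
  0. It loses no mass because monotone paths starting at 0 give \<open>S r \<ge> 0\<close> almost
  surely.\<close>

lemma is_density_subordinator:
  assumes bs: "bernstein_scaling w (laplace_exponent Nu) k1 k2 \<beta>1 \<beta>2"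
    and sub: "driftless_subordinator M S Nu" and smooth: "smooth_bounded_densities M S pbar" and r: "r > 0"
  shows "bernstein_scaling.is_density (laplace_exponent Nu) r (\<lambda>s. if s > 0 then pbar r s else 0)"
proof -
  interpret bernstein_scaling w "laplace_exponent Nu" k1 k2 \<beta>1 \<beta>2 by fact
  let ?p = "\<lambda>s. if s > 0 then pbar r s else 0"
  interpret prob_space M using sub by (simp add: driftless_subordinator_def subordinator_def)
  have dist: "distributed M lborel (S r) (\<lambda>t. ennreal (pbar r t))" and nn: "\<And>t. t > 0 \<Longrightarrow> 0 \<le> pbar r t"
    and bd: "\<exists>B. \<forall>t>0. pbar r t \<le> B" and diff: "(deriv ^^ 0) (pbar r) differentiable_on {0<..}"
    using smooth r unfolding smooth_bounded_densities_def by blast+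
  have [measurable]: "(\<lambda>t. ennreal (pbar r t)) \<in> borel_measurable borel"
    using distributed_borel_measurable[OF dist] by simp
  have [measurable]: "S r \<in> borel_measurable M"
    using distributed_measurable[OF dist] by simp
  \<comment> \<open>Only \<open>ennreal (pbar r t)\<close> is known to be measurable; nonnegativity
    at positive times lets \<open>enn2real\<close> recover \<open>pbar r\<close>.\<close>
  have "?p = (\<lambda>s. if s > 0 then enn2real (ennreal (pbar r s)) else 0)" using nn by auto
  moreover have "\<dots> \<in> borel_measurable borel" by measurable
  ultimately have meas: "?p \<in> borel_measurable borel" by simp
  have S_nonneg: "AE \<omega> in M. S r \<omega> \<ge> 0"
  proof -
    have "AE \<omega> in M. S 0 \<omega> = 0" "AE \<omega> in M. mono_on {0..} (\<lambda>t. S t \<omega>)"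
      using sub by (auto simp: driftless_subordinator_def subordinator_def)
    then show ?thesis
    proof eventually_elim
      case (elim \<omega>)
      then have "S 0 \<omega> \<le> S r \<omega>" using r monotone_onD[OF elim(2), of 0 r] by simp
      then show ?case using elim by simp
    qed
  qed
  have laplace: "(\<integral>\<^sup>+s. ennreal (?p s * exp (- (l * s))) \<partial>lborel) = ennreal (expectation (\<lambda>\<omega>. exp (- (l * S r \<omega>))))" if l: "l \<ge> 0" for l
  proof -
    have "(\<integral>\<^sup>+s. ennreal (?p s * exp (- (l * s))) \<partial>lborel)
       = (\<integral>\<^sup>+s. ennreal (pbar r s) * (ennreal (exp (- (l * s))) * indicator {0..} s) \<partial>lborel)"
      using nn by (intro nn_integral_cong_AE eventually_mono[OF AE_lborel_singleton[of 0]])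
        (auto simp: ennreal_mult[symmetric] split: split_indicator)
    also have "\<dots> = (\<integral>\<^sup>+\<omega>. ennreal (exp (- (l * S r \<omega>))) * indicator {0..} (S r \<omega>) \<partial>M)"
      by (subst distributed_nn_integral[OF dist, symmetric]) auto
    also have "\<dots> = (\<integral>\<^sup>+\<omega>. ennreal (exp (- (l * S r \<omega>))) \<partial>M)"
      using S_nonneg by (intro nn_integral_cong_AE) (auto elim!: eventually_mono)
    also have "\<dots> = ennreal (expectation (\<lambda>\<omega>. exp (- (l * S r \<omega>))))"
    proof (intro nn_integral_eq_integral)
      show "integrable M (\<lambda>\<omega>. exp (- (l * S r \<omega>)))"
        using S_nonneg l by (intro integrable_const_bound[where B = 1]) (auto elim!: eventually_mono)
    qed auto
    finally show ?thesis .
  qed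
  show ?thesis
    unfolding is_density_def
  proof (intro conjI allI impI)
    show "continuous_on {0<..} ?p"
      using differentiable_imp_continuous_on[OF diff] by (subst continuous_on_cong[OF refl, of _ _ "pbar r"]) auto
    obtain B where "\<forall>t>0. pbar r t \<le> B" using bd by blast
    then show "\<exists>B. \<forall>s. ?p s \<le> B" by (intro exI[of _ "max 0 B"]) (auto simp: le_max_iff_disj)
    show "(\<integral>\<^sup>+s. ennreal (?p s) \<partial>lborel) = 1" using laplace[of 0] by (simp add: prob_space)
    show "(\<integral>\<^sup>+s. ennreal (?p s * exp (- (l * s))) \<partial>lborel) = ennreal (exp (- (r * laplace_exponent Nu l)))" if "l > 0" for l
      using laplace[of l] that sub r by (simp add: driftless_subordinator_def)
  qed (use r nn meas in auto)
qed

lemma volume_scale_vol: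
  fixes \<mu> :: "'a::metric_space measure"
  assumes radon: "radon_measure \<mu>"
    and c: "c1 > 0" "c2 > 0" "d2 > 0" "c3 > 0" "\<alpha>1 > 0"
    and vol: "\<And>x r R. 0 < r \<Longrightarrow> r \<le> R \<Longrightarrow>
           c1 * (R / r) powr d1 \<le> vol \<mu> x R / vol \<mu> x r \<and> vol \<mu> x R / vol \<mu> x r \<le> c2 * (R / r) powr d2"
    and Phi: "strict_mono_on {0..} \<Phi>" "\<Phi> 0 = 0"
      "\<And>r R. 0 < r \<Longrightarrow> r \<le> R \<Longrightarrow> c3 * (R / r) powr \<alpha>1 \<le> \<Phi> R / \<Phi> r"
  shows "volume_scale (vol \<mu>) \<Phi> c2 d2 c3 \<alpha>1"
proof
  have sets: "ball x r \<in> sets \<mu>" for x r using radon by (simp add: radon_measure_def)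
  show pos: "vol \<mu> x r > 0" if "r > 0" for x r
  proof -
    \<comment> \<open>With equal radii a zero volume would make the quotient 0, against
      \<open>c1 > 0\<close>.\<close>
    have "vol \<mu> x r \<noteq> 0" using vol[OF that order_refl, of x] c that by auto
    moreover have "vol \<mu> x r \<ge> 0" by (simp add: vol_def)
    ultimately show ?thesis by simp
  qed
  fix r R :: real assume r: "0 < r" "r \<le> R"
  show "vol \<mu> x r \<le> vol \<mu> x R" for x
  proof -
    have "emeasure \<mu> (ball x R) \<noteq> \<infinity>"
      using pos[of R x] r by (auto simp: vol_def measure_def)
    then show ?thesis unfolding vol_def measure_def
      using r sets by (intro enn2real_mono emeasure_mono subset_ball) (auto simp: less_top)
  qed
  show "vol \<mu> x R \<le> c2 * (R / r) powr d2 * vol \<mu> x r" for x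
    using vol[OF r, of x] pos[of r x] r by (simp add: pos_divide_le_eq)
  have "\<Phi> 0 < \<Phi> r" using r strict_mono_onD[OF Phi(1), of 0 r] by simp
  then show "c3 * (R / r) powr \<alpha>1 * \<Phi> r \<le> \<Phi> R"
    using Phi(3)[OF r] Phi(2) by (simp add: pos_le_divide_eq)
qed (use c Phi in auto)

text \<open>The kernel and density bounds are multiplied and handed to the near and far estimates
  with \<open>c0 = 1 / 8\<close>. The prefactor \<open>1 / (t * T)\<close> becomes that of (i); in
  the far case it meets \<open>T^3\<close>, which leaves the \<open>T^2 / t\<close> of (ii).\<close>

lemma (in profile) mixture_bounds:
  fixes p pb :: "real \<Rightarrow> real"
  assumes T: "T > 0" "t > 0" "a \<ge> 0" and cs: "c > 0" "C > 0" "c' > 0" "C' > 0"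
    and p: "\<And>r. r > 0 \<Longrightarrow> c' * J a r \<le> p r" "\<And>r. r > 0 \<Longrightarrow> p r \<le> C' * J a r"
    and pb: "\<And>r. r > 0 \<Longrightarrow> pb r \<ge> 0"
      "\<And>r. 0 < r \<Longrightarrow> r \<le> T \<Longrightarrow> pb r \<le> C / (t * T) * r"
      "\<And>r. T < r \<Longrightarrow> pb r \<le> C / (t * T) * (T ^ 5 / r ^ 4)"
      "\<And>r. 0 < r \<Longrightarrow> r \<le> 1 / 8 * T \<Longrightarrow> c / (t * T) * r \<le> pb r"
  defines "q \<equiv> (\<integral>\<^sup>+r\<in>{0<..}. ennreal (p r * pb r) \<partial>lborel)"
  shows mixture_near: "a \<le> T \<Longrightarrow> ennreal (c' * c / 131072) * (ennreal (1 / (t * T)) * I a (2 * T)) \<le> q \<and>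
      q \<le> ennreal ((2 * D + 1) * (C' * C)) * (ennreal (1 / (t * T)) * I a (2 * T))"
    and mixture_far: "T \<le> a \<Longrightarrow> ennreal (c' * c / 4096) * ennreal (T ^ 2 * g a / (t * a)) \<le> q \<and>
      q \<le> ennreal (2 * (C' * C)) * ennreal (T ^ 2 * g a / (t * a))"
proof -
  have up1: "ennreal (p r * pb r) \<le> ennreal (C' * C / (t * T) * J a r * r)" if r: "0 < r" "r \<le> T" for r
  proof (rule ennreal_leI)
    have "p r * pb r \<le> (C' * J a r) * (C / (t * T) * r)"
      using r T cs p[of r] pb(1,2)[of r] J_pos[of a r] by (intro mult_mono) auto
    then show "p r * pb r \<le> C' * C / (t * T) * J a r * r" by (simp add: mult_ac)
  qed
  have up2: "ennreal (p r * pb r) \<le> ennreal (C' * C / (t * T) * J a r * (T ^ 5 / r ^ 4))" if r: "T < r" for r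
  proof (rule ennreal_leI)
    have "p r * pb r \<le> (C' * J a r) * (C / (t * T) * (T ^ 5 / r ^ 4))"
      using r T cs p[of r] pb(1,3)[of r] J_pos[of a r] by (intro mult_mono) auto
    then show "p r * pb r \<le> C' * C / (t * T) * J a r * (T ^ 5 / r ^ 4)" by (simp add: mult_ac)
  qed
  have low: "ennreal (c' * c / (t * T) * J a r * r) \<le> ennreal (p r * pb r)" if r: "0 < r" "r \<le> 1 / 8 * T" for r
  proof (rule ennreal_leI)
    have Jp: "J a r > 0" using r T by (intro J_pos) auto
    have "(c' * J a r) * (c / (t * T) * r) \<le> p r * pb r"
      using r T cs p(1)[of r] pb(1,4)[of r] Jp
      by (intro mult_mono) (auto intro: order_trans[OF _ p(1)])
    then show "c' * c / (t * T) * J a r * r \<le> p r * pb r" by (simp add: mult_ac)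
  qed
  have pos: "C' * C / (t * T) > 0" "c' * c / (t * T) > 0" using cs T by auto
  { assume a: "a \<le> T"
    \<comment> \<open>\<open>131072 = 8^3 * 256\<close>; in the far case below,
      \<open>4096 = 8^3 * 8\<close>.\<close>
    have "ennreal (c' * c / (t * T) * (1 / 8) ^ 3 / 256) * I a (2 * T) \<le> q"
      unfolding q_def using T a pos low by (intro near_lower) auto
    also have "c' * c / (t * T) * (1 / 8) ^ 3 / 256 = c' * c / 131072 * (1 / (t * T))"
      by (simp add: power_def numeral_eq_Suc)
    finally have l: "ennreal (c' * c / 131072) * (ennreal (1 / (t * T)) * I a (2 * T)) \<le> q"
      using cs T by (subst (asm) ennreal_mult) (auto simp: mult.assoc)
    have "q \<le> ennreal ((2 * D + 1) * (C' * C / (t * T))) * I a (2 * T)"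
      unfolding q_def using T a pos up1 up2 by (intro near_upper) auto
    also have "(2 * D + 1) * (C' * C / (t * T)) = (2 * D + 1) * (C' * C) * (1 / (t * T))" by simp
    also have "ennreal \<dots> = ennreal ((2 * D + 1) * (C' * C)) * ennreal (1 / (t * T))"
      using cs T D_pos by (intro ennreal_mult) auto
    finally show "ennreal (c' * c / 131072) * (ennreal (1 / (t * T)) * I a (2 * T)) \<le> q \<and>
      q \<le> ennreal ((2 * D + 1) * (C' * C)) * (ennreal (1 / (t * T)) * I a (2 * T))"
      using l by (simp add: mult.assoc) }
  { assume a: "T \<le> a"
    then have ga: "g a > 0" using T by (intro g_pos) auto
    have "ennreal (c' * c / (t * T) * (1 / 8 * T) ^ 3 / 8 * g a / a) \<le> q"
      unfolding q_def using T a pos low by (intro far_lower[where T = T and b = "1 / 8 * T" and ?c0.0 = "1 / 8"]) auto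
    also have "c' * c / (t * T) * (1 / 8 * T) ^ 3 / 8 * g a / a = c' * c / 4096 * (T ^ 2 * g a / (t * a))"
      using T by (simp add: power_def numeral_eq_Suc)
    finally have l: "ennreal (c' * c / 4096) * ennreal (T ^ 2 * g a / (t * a)) \<le> q"
      using cs T ga a by (subst (asm) ennreal_mult) auto
    have "q \<le> ennreal (2 * (C' * C / (t * T)) * T ^ 3 * g a / a)"
      unfolding q_def using T a pos up1 up2 by (intro far_upper) auto
    also have "2 * (C' * C / (t * T)) * T ^ 3 * g a / a = 2 * (C' * C) * (T ^ 2 * g a / (t * a))"
      using T by (simp add: power_def numeral_eq_Suc)
    also have "ennreal \<dots> = ennreal (2 * (C' * C)) * ennreal (T ^ 2 * g a / (t * a))"
      using cs T ga a by (intro ennreal_mult) auto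
    finally show "ennreal (c' * c / 4096) * ennreal (T ^ 2 * g a / (t * a)) \<le> q \<and>
      q \<le> ennreal (2 * (C' * C)) * ennreal (T ^ 2 * g a / (t * a))"
      using l by simp }
qed

lemma jump_kernel_bound_eq_J:
  assumes vs: "volume_scale (vol \<mu>) \<Phi> c2 d2 c3 \<alpha>1" and r: "r > 0"
  shows "jump_kernel_bound \<mu> \<Phi> r x y = ennreal (profile.J (volume_scale.g (vol \<mu>) \<Phi> x) (\<Phi> (dist x y)) r)"
proof -
  interpret volume_scale "vol \<mu>" \<Phi> c2 d2 c3 \<alpha>1 by fact
  obtain D where "\<And>x. profile (g x) D" by (rule profile_g) blast
  then interpret profile "g x" D .
  show ?thesis
  proof (cases "dist x y = 0")
    case True
    then have "y = x" by simp
    then show ?thesis using r by (simp add: jump_kernel_bound_def J_def Phi_0 g_def min_def)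
  next
    case False
    then have d: "dist x y > 0" by simp
    note a = Phi_pos[OF d]
    have ga: "g x (\<Phi> (dist x y)) = 1 / vol \<mu> x (dist x y)"
      using a right_inv_Phi[of "dist x y"] by (simp add: g_def)
    have "J (\<Phi> (dist x y)) r = min (1 / vol \<mu> x (right_inv \<Phi> r)) (r / (vol \<mu> x (dist x y) * \<Phi> (dist x y)))"
      using a r by (simp add: J_def ga) (simp add: g_def)
    moreover have "0 \<le> 1 / vol \<mu> x (right_inv \<Phi> r)" "0 \<le> r / (vol \<mu> x (dist x y) * \<Phi> (dist x y))"
      using r a by (auto simp: vol_def)
    ultimately show ?thesis using d
      by (simp add: jump_kernel_bound_def) (auto simp: min_def ennreal_le_iff)
  qed
qed

theorem theorem4p8:
  fixes \<mu> :: "'a::{metric_space, second_countable_topology} measure"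
    and c1 c2 d1 d2 :: real
    and M :: "'v measure" and S :: "real \<Rightarrow> 'v \<Rightarrow> real"
    and Nu :: "real measure" and \<nu> \<phi> :: "real \<Rightarrow> real"
    and \<beta>1 \<beta>2 k1 k2 :: real
    and pbar :: "real \<Rightarrow> real \<Rightarrow> real"
    and \<Phi> :: "real \<Rightarrow> real" and c3 c4 \<alpha>1 \<alpha>2 :: real
    and B :: "('a \<Rightarrow> real) set" and N :: "('a \<Rightarrow> real) \<Rightarrow> real"
    and P0 :: "real \<Rightarrow> ('a \<Rightarrow> real) \<Rightarrow> 'a \<Rightarrow> real"
    and p0 :: "real \<Rightarrow> 'a \<Rightarrow> 'a \<Rightarrow> real"
    and \<Omega> :: "'w measure" and F :: "ennreal \<Rightarrow> 'w measure"
    and Px :: "'a option \<Rightarrow> 'w measure" and X :: "ennreal \<Rightarrow> 'w \<Rightarrow> 'a option"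
  assumes "locally_compact_space (euclidean :: 'a topology)"
    and "radon_measure \<mu>" and "full_support \<mu>"
    and "c1 > 0" and "c2 > 0" and "d1 > 0" and "d2 \<ge> d1"
    and "\<And>x r R. 0 < r \<Longrightarrow> r \<le> R \<Longrightarrow>
           c1 * (R / r) powr d1 \<le> vol \<mu> x R / vol \<mu> x r \<and>
           vol \<mu> x R / vol \<mu> x r \<le> c2 * (R / r) powr d2"
    and "driftless_subordinator M S Nu" and "\<phi> = laplace_exponent Nu"
    and "0 < \<beta>1" and "\<beta>1 < \<beta>2" and "\<beta>2 < 1" and "k1 > 0" and "k2 > 0"
    and "\<And>l \<kappa>. l > 0 \<Longrightarrow> \<kappa> \<ge> 1 \<Longrightarrow>
           k1 * \<kappa> powr \<beta>1 \<le> \<phi> (\<kappa> * l) / \<phi> l \<and> \<phi> (\<kappa> * l) / \<phi> l \<le> k2 * \<kappa> powr \<beta>2"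
    and "\<phi> 1 = 1"
    and "\<nu> \<in> borel_measurable borel" and "\<And>z. z > 0 \<Longrightarrow> \<nu> z \<ge> 0"
    and "Nu = density lborel (\<lambda>z. ennreal (\<nu> z * indicator {0<..} z))"
    and "antimono_on {0<..} (\<lambda>z. z * \<nu> z)"
    and "smooth_bounded_densities M S pbar"
    and "strict_mono_on {0..} \<Phi>" and "\<Phi> 0 = 0"
    and "c3 > 0" and "c4 > 0" and "0 < \<alpha>1" and "\<alpha>1 \<le> \<alpha>2"
    and "\<And>r R. 0 < r \<Longrightarrow> r \<le> R \<Longrightarrow>
           c3 * (R / r) powr \<alpha>1 \<le> \<Phi> R / \<Phi> r \<and> \<Phi> R / \<Phi> r \<le> c4 * (R / r) powr \<alpha>2"
    and "(\<exists>p\<ge>1. B = Lp_space \<mu> p \<and> N = Lp_norm \<mu> p) \<or> (B = C_infinity \<and> N = sup_norm)"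
    and "bounded_C0_semigroup B N P0"
    and "strong_markov_process \<Omega> F Px X"
    and "semigroup_of_process B N P0 Px X"
    and "pure_jump B N P0 \<mu> Px X"
    and "has_density_kernel B N P0 \<mu> p0"
    and "comparable_on {(t, x, y). t > 0}
           (\<lambda>(t, x, y). ennreal (p0 t x y)) (\<lambda>(t, x, y). jump_kernel_bound \<mu> \<Phi> t x y)"
  shows "comparable_on {(t, x, y). t > 0 \<and> \<Phi> (dist x y) * \<phi> (1 / t) \<le> 1}
           (\<lambda>(t, x, y). q_kernel p0 pbar t x y)
           (\<lambda>(t, x, y). ennreal (\<phi> (1 / t) / t) *
              (\<integral>\<^sup>+r\<in>{\<Phi> (dist x y)..2 / \<phi> (1 / t)}. ennreal (r / vol \<mu> x (right_inv \<Phi> r)) \<partial>lborel))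
       \<and> comparable_on {(t, x, y). t > 0 \<and> \<Phi> (dist x y) * \<phi> (1 / t) \<ge> 1}
           (\<lambda>(t, x, y). q_kernel p0 pbar t x y)
           (\<lambda>(t, x, y). ennreal (1 / (t * (\<phi> (1 / t))\<^sup>2 * vol \<mu> x (dist x y) * \<Phi> (dist x y))))"
proof -
  define w where "w z = (if z > 0 then z * \<nu> z else 0)" for z :: real
  interpret L: bernstein_scaling w \<phi> k1 k2 \<beta>1 \<beta>2
    using assms(9,10,11,12,13,14,15,16,18,19,20,21)
    unfolding w_def by (auto intro!: bernstein_scaling_laplace_exponent simp: driftless_subordinator_def)
  have vs: "volume_scale (vol \<mu>) \<Phi> c2 d2 c3 \<alpha>1"
    by (rule volume_scale_vol[where ?c1.0 = c1 and ?d1.0 = d1]) (use assms in auto)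
  interpret G: volume_scale "vol \<mu>" \<Phi> c2 d2 c3 \<alpha>1 by (rule vs)
  obtain D where prof: "\<And>x. profile (G.g x) D" by (rule G.profile_g) blast
  have D: "D > 0" using prof by (rule profile.D_pos)
  have dens: "L.is_density r (\<lambda>s. if s > 0 then pbar r s else 0)" if "r > 0" for r
    using is_density_subordinator[of w Nu k1 k2 \<beta>1 \<beta>2 M S pbar r] L.bernstein_scaling_axioms assms that by simp
  have pbar_nn: "pbar r t \<ge> 0" if "r > 0" "t > 0" for r t
    using L.p_nonneg[OF dens[OF that(1)], of t] that by simp
  obtain c' C' where c': "c' > 0" "C' > 0"
    and p0: "\<And>t x y. t > 0 \<Longrightarrow> ennreal c' * jump_kernel_bound \<mu> \<Phi> t x y \<le> ennreal (p0 t x y)"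
      "\<And>t x y. t > 0 \<Longrightarrow> ennreal (p0 t x y) \<le> ennreal C' * jump_kernel_bound \<mu> \<Phi> t x y"
    using assms(36) unfolding comparable_on_def by fastforce
  show ?thesis
  proof (rule L.density_bounds)
    fix c C :: real
    assume c: "c > 0" "C > 0"
      and up1: "\<And>r p t T. L.is_density r p \<Longrightarrow> t > 0 \<Longrightarrow> T = 1 / \<phi> (1 / t) \<Longrightarrow> r \<le> T \<Longrightarrow> p t \<le> C / (t * T) * r"
      and up2: "\<And>r p t T. L.is_density r p \<Longrightarrow> t > 0 \<Longrightarrow> T = 1 / \<phi> (1 / t) \<Longrightarrow> T < r \<Longrightarrow> p t \<le> C / (t * T) * (T ^ 5 / r ^ 4)"
      and low: "\<And>r p t T. L.is_density r p \<Longrightarrow> t > 0 \<Longrightarrow> T = 1 / \<phi> (1 / t) \<Longrightarrow> r \<le> 1 / 8 * T \<Longrightarrow> c / (t * T) * r \<le> p t"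
    have bounds: "(\<Phi> (dist x y) * \<phi> (1 / t) \<le> 1 \<longrightarrow>
          ennreal (c' * c / 131072) * (ennreal (\<phi> (1 / t) / t) * (\<integral>\<^sup>+r\<in>{\<Phi> (dist x y)..2 / \<phi> (1 / t)}. ennreal (r / vol \<mu> x (right_inv \<Phi> r)) \<partial>lborel)) \<le> q_kernel p0 pbar t x y \<and>
          q_kernel p0 pbar t x y \<le> ennreal ((2 * D + 1) * (C' * C)) * (ennreal (\<phi> (1 / t) / t) * (\<integral>\<^sup>+r\<in>{\<Phi> (dist x y)..2 / \<phi> (1 / t)}. ennreal (r / vol \<mu> x (right_inv \<Phi> r)) \<partial>lborel))) \<and>
        (\<Phi> (dist x y) * \<phi> (1 / t) \<ge> 1 \<longrightarrow>
          ennreal (c' * c / 4096) * ennreal (1 / (t * (\<phi> (1 / t))\<^sup>2 * vol \<mu> x (dist x y) * \<Phi> (dist x y))) \<le> q_kernel p0 pbar t x y \<and>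
          q_kernel p0 pbar t x y \<le> ennreal (2 * (C' * C)) * ennreal (1 / (t * (\<phi> (1 / t))\<^sup>2 * vol \<mu> x (dist x y) * \<Phi> (dist x y))))"
      if t: "t > 0" for t x y
    proof -
      interpret profile "G.g x" D by (rule prof)
      define a where "a = \<Phi> (dist x y)"
      define T where "T = 1 / \<phi> (1 / t)"
      have phi: "\<phi> (1 / t) > 0" using t L.phi_pos by simp
      have T: "T > 0" using phi by (simp add: T_def)
      have a: "a \<ge> 0" by (simp add: a_def G.Phi_nonneg)
      have p0_low: "c' * J a r \<le> p0 r x y" if r: "r > 0" for r
      proof -
        \<comment> \<open>\<open>p0\<close> is real-valued with no sign given. A positive lower
          bound in \<open>ennreal\<close> excludes that \<open>p0 r x y\<close> was truncated to 0,
          so the inequality passes to the reals.\<close>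
        have pos: "0 < c' * J a r" using J_pos[OF a r] c' by simp
        show ?thesis
          using p0(1)[OF r, of x y] c' J_pos[OF a r] pos
          by (simp add: jump_kernel_bound_eq_J[OF vs r] a_def[symmetric] ennreal_mult[symmetric] ennreal_le_iff2)
      qed
      have p0_up: "p0 r x y \<le> C' * J a r" if r: "r > 0" for r
        using p0(2)[OF r, of x y] c' J_pos[OF a r]
        by (simp add: jump_kernel_bound_eq_J[OF vs r] a_def[symmetric] ennreal_mult[symmetric])
      have pb: "pbar r t \<ge> 0" "r \<le> T \<Longrightarrow> pbar r t \<le> C / (t * T) * r"
        "T < r \<Longrightarrow> pbar r t \<le> C / (t * T) * (T ^ 5 / r ^ 4)"
        "r \<le> 1 / 8 * T \<Longrightarrow> c / (t * T) * r \<le> pbar r t" if r: "r > 0" for r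
        using pbar_nn[OF r t] up1[OF dens[OF r] t T_def] up2[OF dens[OF r] t T_def] low[OF dens[OF r] t T_def] t
        by simp_all
      note near = mixture_near[OF T t a c c' p0_low p0_up, of "\<lambda>r. pbar r t", folded q_kernel_def]
      note far = mixture_far[OF T t a c c' p0_low p0_up, of "\<lambda>r. pbar r t", folded q_kernel_def]
      have I: "I a (2 * T) = (\<integral>\<^sup>+r\<in>{\<Phi> (dist x y)..2 / \<phi> (1 / t)}. ennreal (r / vol \<mu> x (right_inv \<Phi> r)) \<partial>lborel)"
      proof -
        \<comment> \<open>The point \<open>r = 0\<close> belongs to the range on the diagonal; both
          integrands are 0 there.\<close>
        have "ennreal (r * G.g x r) * indicator {a..2 * T} r = ennreal (r / vol \<mu> x (right_inv \<Phi> r)) * indicator {a..2 * T} r" for r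
          using a by (cases "r > 0"; cases "r = 0") (auto simp: G.g_def split: split_indicator)
        then show ?thesis unfolding I_def by (simp add: a_def T_def)
      qed
      have "1 / (t * T) = \<phi> (1 / t) / t" by (simp add: T_def)
      moreover have "a \<le> T \<longleftrightarrow> \<Phi> (dist x y) * \<phi> (1 / t) \<le> 1" "T \<le> a \<longleftrightarrow> \<Phi> (dist x y) * \<phi> (1 / t) \<ge> 1"
        using phi by (auto simp: a_def T_def pos_le_divide_eq pos_divide_le_eq)
      \<comment> \<open>\<open>T \<le> a\<close> forces \<open>a > 0\<close>, so \<open>g\<close> is
        evaluated on the positive axis, where \<open>right_inv_Phi\<close> identifies the radius as
        \<open>dist x y\<close>.\<close>
      moreover have "T ^ 2 * G.g x a / (t * a) = 1 / (t * (\<phi> (1 / t))\<^sup>2 * vol \<mu> x (dist x y) * \<Phi> (dist x y))" if "T \<le> a"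
      proof -
        have "G.g x a = 1 / vol \<mu> x (dist x y)"
          using that T G.right_inv_Phi[of "dist x y"] by (simp add: G.g_def a_def)
        then show ?thesis by (simp add: T_def a_def power_divide)
      qed
      ultimately show ?thesis
        using near far pb T I by auto
    qed
    show ?thesis
      unfolding comparable_on_def
    proof (intro conjI)
      show "\<exists>c>0. \<exists>C>0. \<forall>i\<in>{(t, x, y). t > 0 \<and> \<Phi> (dist x y) * \<phi> (1 / t) \<le> 1}.
          ennreal c * (case i of (t, x, y) \<Rightarrow> ennreal (\<phi> (1 / t) / t) *
              (\<integral>\<^sup>+r\<in>{\<Phi> (dist x y)..2 / \<phi> (1 / t)}. ennreal (r / vol \<mu> x (right_inv \<Phi> r)) \<partial>lborel))
            \<le> (case i of (t, x, y) \<Rightarrow> q_kernel p0 pbar t x y) \<and>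
          (case i of (t, x, y) \<Rightarrow> q_kernel p0 pbar t x y) \<le> ennreal C * (case i of (t, x, y) \<Rightarrow> ennreal (\<phi> (1 / t) / t) *
              (\<integral>\<^sup>+r\<in>{\<Phi> (dist x y)..2 / \<phi> (1 / t)}. ennreal (r / vol \<mu> x (right_inv \<Phi> r)) \<partial>lborel))"
        using c c' D bounds by (intro exI[of _ "c' * c / 131072"] conjI exI[of _ "(2 * D + 1) * (C' * C)"]) auto
      show "\<exists>c>0. \<exists>C>0. \<forall>i\<in>{(t, x, y). t > 0 \<and> \<Phi> (dist x y) * \<phi> (1 / t) \<ge> 1}.
          ennreal c * (case i of (t, x, y) \<Rightarrow> ennreal (1 / (t * (\<phi> (1 / t))\<^sup>2 * vol \<mu> x (dist x y) * \<Phi> (dist x y))))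
            \<le> (case i of (t, x, y) \<Rightarrow> q_kernel p0 pbar t x y) \<and>
          (case i of (t, x, y) \<Rightarrow> q_kernel p0 pbar t x y) \<le> ennreal C *
            (case i of (t, x, y) \<Rightarrow> ennreal (1 / (t * (\<phi> (1 / t))\<^sup>2 * vol \<mu> x (dist x y) * \<Phi> (dist x y))))"
        using c c' bounds by (intro exI[of _ "c' * c / 4096"] conjI exI[of _ "2 * (C' * C)"]) auto
    qed
  qed
qed

end
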